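(* Let $R$ be a commutative ring with unit. (a) For any $\alpha,\beta,\gamma\in\mathcal A$ and any double cosets $\mathfrak a\in Q_\alpha\backslash \mathrm{GL}(2\infty,R)/Q_\beta$, $\mathfrak b\in Q_\beta\backslash \mathrm{GL}(2\infty,R)/Q_\gamma$, the double coset $\mathfrak a\star\mathfrak b\in Q_\alpha\backslash \mathrm{GL}(2\infty,R)/Q_\gamma$ defined as the double coset containing $A\star B$ does not depend on the choice of representatives $A\in\mathfrak a$ and $B\in\mathfrak b$ (written in finite block form as in the definition of $A\star B$). (b) The $\star$-multiplication is associative: for any $\alpha,\beta,\gamma,\delta\in\mathcal A$ and any $\mathfrak a\in Q_\alpha\backslash \mathrm{GL}(2\infty,R)/Q_\beta$, $\mathfrak b\in Q_\beta\backslash \mathrm{GL}(2\infty,R)/Q_\gamma$, $\mathfrak c\in Q_\gamma\backslash \mathrm{GL}(2\infty,R)/Q_\delta$, one has $(\mathfrak a\star\mathfrak b)\star\mathfrak c=\mathfrak a\star(\mathfrak b\star\mathfrak c)$.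
   Context: $\mathrm{GL}(2\infty,R)$ is the group of invertible two-sided infinite matrices $g=(g_{ij})_{i,j\in\mathbb Z}$ over $R$ that are finitary, i.e. $g-1$ has only finitely many nonzero entries; it acts on the space $R^{2\infty}$ of finitely supported columns $(v_j)_{j\in\mathbb Z}$. $\mathcal A$ is the set of pairs $\alpha=(\alpha_-,\alpha_+)$ of integers with $\alpha_-\le\alpha_+$, and $|\alpha|=\alpha_+-\alpha_-$. For $\alpha\in\mathcal A$ decompose $R^{2\infty}=R_\alpha^-\oplus R_\alpha\oplus R_\alpha^+$, the summands consisting of sequences supported on $j\le\alpha_-$, on $\alpha_-<j\le\alpha_+$, and on $j>\alpha_+$, respectively. $Q_\alpha\subset\mathrm{GL}(2\infty,R)$ is the subgroup of matrices which in this decomposition have the block form $\begin{pmatrix} * & * & * \\ 0 & 1 & * \\ 0 & 0 & * \end{pmatrix}$. Definition of $A\star B$. Let $A\in\mathfrak a\in Q_\alpha\backslash \mathrm{GL}(2\infty,R)/Q_\beta$ and $B\in\mathfrak b\in Q_\beta\backslash \mathrm{GL}(2\infty,R)/Q_\gamma$. Choose integers $N_\pm,M_\pm,K_\pm\ge0$ with $\alpha_--N_-=\beta_--M_-=\gamma_--K_-=:s$ and $\alpha_++N_+=\beta_++M_+=\gamma_++K_+=:t$, such that all entries of $A$ and $B$ outside the square $s<i,j\le t$ are those of the identity matrix (this is possible by taking $s$ small and $t$ large). Write the finite square part of $A$ as a block matrix $(a_{ij})_{1\le i,j\le 3}$ with row sizes $N_-,|\alpha|,N_+$ and column sizes $M_-,|\beta|,M_+$,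 and that of $B$ as $(b_{ij})_{1\le i,j\le3}$ with row sizes $M_-,|\beta|,M_+$ and column sizes $K_-,|\gamma|,K_+$. Put $$A^\circ=\begin{pmatrix} 1_{M_-} & 0 & 0 & 0 & 0 \\ 0 & a_{11} & a_{12} & a_{13} & 0 \\ 0 & a_{21} & a_{22} & a_{23} & 0 \\ 0 & a_{31} & a_{32} & a_{33} & 0 \\ 0 & 0 & 0 & 0 & 1_{M_+} \end{pmatrix},\qquad B^\lozenge=\begin{pmatrix} b_{11} & 0 & b_{12} & 0 & b_{13} \\ 0 & 1_{M_-} & 0 & 0 & 0 \\ b_{21} & 0 & b_{22} & 0 & b_{23} \\ 0 & 0 & 0 & 1_{M_+} & 0 \\ b_{31} & 0 & b_{32} & 0 & b_{33} \end{pmatrix}.$$ The product $A^\circ B^\lozenge$ is a finite square matrix whose rows are split as $(M_-+N_-)+|\alpha|+(N_++M_+)$ and whose columns are split as $(K_-+M_-)+|\gamma|+(M_++K_+)$. $A\star B\in\mathrm{GL}(2\infty,R)$ is the matrix obtained by placing $A^\circ B^\lozenge$ at the index range $s-M_-<i,j\le t+M_+$ (so the middle group of rows is $\alpha_-<i\le\alpha_+$ and the middle group of columns is $\gamma_-<j\le\gamma_+$) and completing it by the identity outside. *)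

theory Defs
  imports "Jordan_Normal_Form.Matrix"
begin

type_synonym 'a zmat = "int \<Rightarrow> int \<Rightarrow> 'a"

definition zone :: "'a::comm_ring_1 zmat" where
  "zone = (\<lambda>i j. if i = j then 1 else 0)"

text \<open>The sum runs over the support of row \<open>i\<close> of \<open>g\<close>, which is finite for finitary \<open>g\<close>.\<close>

definition zmult :: "'a::comm_ring_1 zmat \<Rightarrow> 'a zmat \<Rightarrow> 'a zmat" where
  "zmult g h = (\<lambda>i j. \<Sum>k | g i k \<noteq> 0. g i k * h k j)"

definition finitary :: "'a::comm_ring_1 zmat \<Rightarrow> bool" where
  "finitary g \<longleftrightarrow> finite {(i, j). g i j - zone i j \<noteq> 0}"

text \<open>Asking the inverse to be finitary is no restriction: off a finite square a finitary matrix is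
  the identity, so its inverse on finitely supported columns is finitary as well.\<close>

definition GL :: "'a::comm_ring_1 zmat set" where
  "GL = {g. finitary g \<and> (\<exists>h. finitary h \<and> zmult g h = zone \<and> zmult h g = zone)}"

definition Ivals :: "(int \<times> int) set" where
  "Ivals = {(l, u). l \<le> u}"

text \<open>For \<open>\<alpha> = (l, u)\<close> the three index groups are \<open>j \<le> l\<close>, \<open>l < j \<le> u\<close> and \<open>u < j\<close>.\<close>

definition Q :: "int \<times> int \<Rightarrow> 'a::comm_ring_1 zmat set" where
  "Q \<alpha> = {g \<in> GL.
     (\<forall>i j. fst \<alpha> < i \<and> i \<le> snd \<alpha> \<and> j \<le> fst \<alpha> \<longrightarrow> g i j = 0) \<and>
     (\<forall>i j. fst \<alpha> < i \<and> i \<le> snd \<alpha> \<and> fst \<alpha> < j \<and> j \<le> snd \<alpha> \<longrightarrow> g i j = zone i j) \<and>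
     (\<forall>i j. snd \<alpha> < i \<and> j \<le> fst \<alpha> \<longrightarrow> g i j = 0) \<and>
     (\<forall>i j. snd \<alpha> < i \<and> fst \<alpha> < j \<and> j \<le> snd \<alpha> \<longrightarrow> g i j = 0)}"

definition dcoset :: "int \<times> int \<Rightarrow> int \<times> int \<Rightarrow> 'a::comm_ring_1 zmat \<Rightarrow> 'a zmat set" where
  "dcoset \<alpha> \<beta> g = {zmult (zmult p g) q |p q. p \<in> Q \<alpha> \<and> q \<in> Q \<beta>}"

definition dcosets :: "int \<times> int \<Rightarrow> int \<times> int \<Rightarrow> 'a::comm_ring_1 zmat set set" where
  "dcosets \<alpha> \<beta> = dcoset \<alpha> \<beta> ` GL"

definition hcat :: "'a::zero mat \<Rightarrow> 'a mat \<Rightarrow> 'a mat" where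
  "hcat X Y = four_block_mat X Y (0\<^sub>m 0 (dim_col X)) (0\<^sub>m 0 (dim_col Y))"

definition vcat :: "'a::zero mat \<Rightarrow> 'a mat \<Rightarrow> 'a mat" where
  "vcat X Y = four_block_mat X (0\<^sub>m (dim_row X) 0) Y (0\<^sub>m (dim_row Y) 0)"

text \<open>The matrix assembled from a list of rows of blocks. A row of blocks has the height of its
  first block.\<close>

definition block_mat :: "'a::zero mat list list \<Rightarrow> 'a mat" where
  "block_mat Xss = foldr vcat (map (\<lambda>Xs. foldr hcat Xs (0\<^sub>m 0 0)) Xss) (0\<^sub>m 0 0)"

text \<open>The finite matrix formed by the rows \<open>p < i \<le> p'\<close> and the columns \<open>q < j \<le> q'\<close>.\<close>

definition sub_block :: "'a zmat \<Rightarrow> int \<Rightarrow> int \<Rightarrow> int \<Rightarrow> int \<Rightarrow> 'a mat" where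
  "sub_block g p p' q q' =
     mat (nat (p' - p)) (nat (q' - q)) (\<lambda>(i, j). g (p + 1 + int i) (q + 1 + int j))"

text \<open>The finite square matrix \<open>X\<close> placed at \<open>u < i, j \<le> v\<close> and completed by the identity.\<close>

definition place :: "int \<Rightarrow> int \<Rightarrow> 'a::comm_ring_1 mat \<Rightarrow> 'a zmat" where
  "place u v X = (\<lambda>i j.
     if u < i \<and> i \<le> v \<and> u < j \<and> j \<le> v then X $$ (nat (i - u - 1), nat (j - u - 1))
     else zone i j)"

definition supported :: "int \<Rightarrow> int \<Rightarrow> 'a::comm_ring_1 zmat \<Rightarrow> bool" where
  "supported s t g \<longleftrightarrow> (\<forall>i j. \<not> (s < i \<and> i \<le> t \<and> s < j \<and> j \<le> t) \<longrightarrow> g i j = zone i j)"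

text \<open>The numbers \<open>N\<close>, \<open>M\<close>, \<open>K\<close> (with signs) of the construction are determined by \<open>s\<close> and \<open>t\<close>,
  for instance the left one for \<open>\<alpha>\<close> is \<open>fst \<alpha> - s\<close> and the right one is \<open>t - snd \<alpha>\<close>.
  Their nonnegativity is what the inequalities below express.\<close>

definition admissible ::
  "int \<times> int \<Rightarrow> int \<times> int \<Rightarrow> int \<times> int \<Rightarrow> int \<Rightarrow> int \<Rightarrow> 'a::comm_ring_1 zmat \<Rightarrow> 'a zmat \<Rightarrow> bool"
where
  "admissible \<alpha> \<beta> \<gamma> s t A B \<longleftrightarrow>
     (\<forall>\<epsilon> \<in> {\<alpha>, \<beta>, \<gamma>}. s \<le> fst \<epsilon> \<and> snd \<epsilon> \<le> t) \<and> supported s t A \<and> supported s t B"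

definition circ ::
  "int \<times> int \<Rightarrow> int \<times> int \<Rightarrow> int \<Rightarrow> int \<Rightarrow> 'a::comm_ring_1 zmat \<Rightarrow> 'a mat"
where
  "circ \<alpha> \<beta> s t A =
    (let Nm = nat (fst \<alpha> - s); a = nat (snd \<alpha> - fst \<alpha>); Np = nat (t - snd \<alpha>);
         Mm = nat (fst \<beta> - s); b = nat (snd \<beta> - fst \<beta>); Mp = nat (t - snd \<beta>);
         a11 = sub_block A s (fst \<alpha>) s (fst \<beta>);
         a12 = sub_block A s (fst \<alpha>) (fst \<beta>) (snd \<beta>);
         a13 = sub_block A s (fst \<alpha>) (snd \<beta>) t;
         a21 = sub_block A (fst \<alpha>) (snd \<alpha>) s (fst \<beta>);
         a22 = sub_block A (fst \<alpha>) (snd \<alpha>) (fst \<beta>) (snd \<beta>);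
         a23 = sub_block A (fst \<alpha>) (snd \<alpha>) (snd \<beta>) t;
         a31 = sub_block A (snd \<alpha>) t s (fst \<beta>);
         a32 = sub_block A (snd \<alpha>) t (fst \<beta>) (snd \<beta>);
         a33 = sub_block A (snd \<alpha>) t (snd \<beta>) t
     in block_mat
       [[1\<^sub>m Mm,    0\<^sub>m Mm Mm, 0\<^sub>m Mm b, 0\<^sub>m Mm Mp, 0\<^sub>m Mm Mp],
        [0\<^sub>m Nm Mm, a11,      a12,     a13,      0\<^sub>m Nm Mp],
        [0\<^sub>m a Mm,  a21,      a22,     a23,      0\<^sub>m a Mp],
        [0\<^sub>m Np Mm, a31,      a32,     a33,      0\<^sub>m Np Mp],
        [0\<^sub>m Mp Mm, 0\<^sub>m Mp Mm, 0\<^sub>m Mp b, 0\<^sub>m Mp Mp, 1\<^sub>m Mp]])"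

definition lozenge ::
  "int \<times> int \<Rightarrow> int \<times> int \<Rightarrow> int \<Rightarrow> int \<Rightarrow> 'a::comm_ring_1 zmat \<Rightarrow> 'a mat"
where
  "lozenge \<beta> \<gamma> s t B =
    (let Mm = nat (fst \<beta> - s); b = nat (snd \<beta> - fst \<beta>); Mp = nat (t - snd \<beta>);
         Km = nat (fst \<gamma> - s); c = nat (snd \<gamma> - fst \<gamma>); Kp = nat (t - snd \<gamma>);
         b11 = sub_block B s (fst \<beta>) s (fst \<gamma>);
         b12 = sub_block B s (fst \<beta>) (fst \<gamma>) (snd \<gamma>);
         b13 = sub_block B s (fst \<beta>) (snd \<gamma>) t;
         b21 = sub_block B (fst \<beta>) (snd \<beta>) s (fst \<gamma>);
         b22 = sub_block B (fst \<beta>) (snd \<beta>) (fst \<gamma>) (snd \<gamma>);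
         b23 = sub_block B (fst \<beta>) (snd \<beta>) (snd \<gamma>) t;
         b31 = sub_block B (snd \<beta>) t s (fst \<gamma>);
         b32 = sub_block B (snd \<beta>) t (fst \<gamma>) (snd \<gamma>);
         b33 = sub_block B (snd \<beta>) t (snd \<gamma>) t
     in block_mat
       [[b11,      0\<^sub>m Mm Mm, b12,     0\<^sub>m Mm Mp, b13],
        [0\<^sub>m Mm Km, 1\<^sub>m Mm,    0\<^sub>m Mm c, 0\<^sub>m Mm Mp, 0\<^sub>m Mm Kp],
        [b21,      0\<^sub>m b Mm,  b22,     0\<^sub>m b Mp,  b23],
        [0\<^sub>m Mp Km, 0\<^sub>m Mp Mm, 0\<^sub>m Mp c, 1\<^sub>m Mp,    0\<^sub>m Mp Kp],
        [b31,      0\<^sub>m Mp Mm, b32,     0\<^sub>m Mp Mp, b33]])"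

definition star ::
  "int \<times> int \<Rightarrow> int \<times> int \<Rightarrow> int \<times> int \<Rightarrow> int \<Rightarrow> int \<Rightarrow>
    'a::comm_ring_1 zmat \<Rightarrow> 'a zmat \<Rightarrow> 'a zmat"
where
  "star \<alpha> \<beta> \<gamma> s t A B =
     place (s - (fst \<beta> - s)) (t + (t - snd \<beta>)) (circ \<alpha> \<beta> s t A * lozenge \<beta> \<gamma> s t B)"

text \<open>\<open>c\<close> is a double coset that contains \<open>A \<star> B\<close> for every choice of the representatives \<open>A\<close>,
  \<open>B\<close> and of the finite square used to write them in block form.\<close>

definition is_product ::
  "int \<times> int \<Rightarrow> int \<times> int \<Rightarrow> int \<times> int \<Rightarrow>
    'a::comm_ring_1 zmat set \<Rightarrow> 'a zmat set \<Rightarrow> 'a zmat set \<Rightarrow> bool"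
where
  "is_product \<alpha> \<beta> \<gamma> a b c \<longleftrightarrow> c \<in> dcosets \<alpha> \<gamma> \<and>
     (\<forall>A \<in> a. \<forall>B \<in> b. \<forall>s t. admissible \<alpha> \<beta> \<gamma> s t A B \<longrightarrow> star \<alpha> \<beta> \<gamma> s t A B \<in> c)"

definition coset_star ::
  "int \<times> int \<Rightarrow> int \<times> int \<Rightarrow> int \<times> int \<Rightarrow>
    'a::comm_ring_1 zmat set \<Rightarrow> 'a zmat set \<Rightarrow> 'a zmat set"
where
  "coset_star \<alpha> \<beta> \<gamma> a b = (THE c. is_product \<alpha> \<beta> \<gamma> a b c)"

end

theory Submission imports Defs "Jordan_Normal_Form.Determinant"
begin

text \<open>
  Placing \<open>circ\<close> at its index range gives back \<open>A\<close>, and placing \<open>lozenge\<close> there gives \<open>B\<close> with rows and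
  columns permuted. So \<open>A \<star> B = A \<rho> B \<kappa>\<close> for two permutation matrices (\<open>star_eq\<close>). The permutation \<open>\<kappa>\<close>
  respects the three index groups of \<open>\<gamma>\<close> and fixes the middle one pointwise, so its
  matrix lies in \<open>Q \<gamma>\<close> and the double coset is that of \<open>A \<rho> B\<close>. The permutation \<open>\<rho>\<close> respects the
  groups of \<open>\<beta>\<close> in the same way and carries the part of the square of \<open>B\<close> outside \<open>\<beta>\<close> to indices where \<open>A\<close> is the identity: it
  \<^emph>\<open>separates\<close> \<open>A\<close> from \<open>B\<close>. The theorem is about the double cosets of \<open>A \<sigma> B\<close> for separating \<open>\<sigma>\<close>.

  \<^item> \<^emph>\<open>The choice of \<open>\<sigma>\<close> does not matter.\<close> A permutation \<open>d\<close> that sends the part of \<open>B\<close> outside \<open>\<beta>\<close> very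
    far away is \<open>u \<sigma> v\<close>, where \<open>u\<close> fixes the square of \<open>A\<close> and \<open>v\<close> fixes the square of \<open>B\<close>
    (\<open>separating_factorization\<close>). Then \<open>u\<close> commutes with \<open>A\<close> and \<open>v\<close> with \<open>B\<close>, and they are absorbed by
    \<open>Q \<alpha>\<close> and \<open>Q \<gamma>\<close>. Any two separating permutations are compared through the same \<open>d\<close>.

  \<^item> \<^emph>\<open>The choice of \<open>A\<close> and \<open>B\<close> does not matter.\<close> Let \<open>q \<in> Q \<beta>\<close> and let \<open>d\<close> separate a large square
    \<open>(s, t]\<close> from itself. Passing \<open>q\<close> from one side of \<open>d\<close> to the other turns it into an element of
    \<open>Q (s, t)\<close> (\<open>separates_conjugate_Q\<close>), and a matrix supported in \<open>(s, t]\<close> normalises \<open>Q (s, t)\<close>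
    (\<open>conjugate_Q_supported\<close>). So \<open>q\<close> can be pushed through \<open>A\<close> or \<open>B\<close>, and \<open>Q (s, t)\<close> is contained
    in both \<open>Q \<alpha>\<close> and \<open>Q \<gamma>\<close>.

  \<^item> \<^emph>\<open>Associativity.\<close> Both bracketings give the double coset of a matrix \<open>A \<sigma> B \<tau> C\<close>. For the left one
    \<open>\<tau>\<close> has to move further than \<open>\<sigma>\<close>, for the right one \<open>\<sigma>\<close> has to move further than \<open>\<tau>\<close>. The two
    requirements are reconciled by a permutation \<open>\<kappa>\<close> that commutes with \<open>A\<close>, \<open>B\<close>, \<open>C\<close> and \<open>\<tau>\<close> and
    for which \<open>\<kappa> \<sigma> \<kappa>\<close> moves far enough (\<open>coset_star_assoc\<close>).

  Double cosets have to partition the group, so \<open>Q \<alpha>\<close> has to be closed under inverses. This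
  is where commutativity of the ring enters: a one-sided inverse of a finite square matrix is two-sided,
  and hence the inverse of a block triangular matrix is block triangular (\<open>ginv_block_triangular\<close>).
\<close>

unbundle no m_inv_syntax
notation zmult (infixl \<open>\<odot>\<close> 70)

section \<open>Finitary matrices\<close>

lemma zone_simps [simp]: "zone i i = 1" "i \<noteq> j \<Longrightarrow> zone i j = 0"
  by (auto simp: zone_def)

lemma supportedD: "supported s t g \<Longrightarrow> \<not> (s < i \<and> i \<le> t \<and> s < j \<and> j \<le> t) \<Longrightarrow> g i j = zone i j"
  by (auto simp: supported_def)

lemma supported_mono:
  "supported s t g \<Longrightarrow> s' \<le> s \<Longrightarrow> t \<le> t' \<Longrightarrow> supported s' t' g"
  unfolding supported_def by (meson le_less_trans order_trans)

lemma finitary_supported: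
  assumes "supported s t g"
  shows "finitary g"
proof -
  have "(i, j) \<in> {s<..t} \<times> {s<..t}" if "g i j - zone i j \<noteq> 0" for i j
    using supportedD[OF assms, of i j] that by auto
  then have "{(i, j). g i j - zone i j \<noteq> 0} \<subseteq> {s<..t} \<times> {s<..t}"
    by blast
  then show ?thesis
    unfolding finitary_def by (rule finite_subset) simp
qed

text \<open>The filter of large \<open>n\<close> makes it easy to pass to one square that serves several matrices at once.\<close>

lemma eventually_supported:
  assumes "finitary g"
  shows "eventually (\<lambda>n. supported (- n) n g) at_top"
proof -
  define S where "S = {(i, j). g i j - zone i j \<noteq> 0}"
  define m where "m = Max (insert 0 ((\<lambda>(i, j). max (abs i) (abs j)) ` S))"
  have fin: "finite S"
    using assms by (simp add: S_def finitary_def)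
  have m: "abs i \<le> m \<and> abs j \<le> m" if "(i, j) \<in> S" for i j
  proof -
    have "max (abs i) (abs j) \<le> m"
      unfolding m_def using fin that by (intro Max_ge) (auto intro!: image_eqI)
    then show ?thesis by simp
  qed
  have "supported (- n) n g" if "n > m" for n
    unfolding supported_def
  proof (intro allI impI, rule ccontr)
    fix i j assume out: "\<not> (- n < i \<and> i \<le> n \<and> - n < j \<and> j \<le> n)" and "g i j \<noteq> zone i j"
    then have "(i, j) \<in> S" by (simp add: S_def)
    then show False using m[of i j] that out by linarith
  qed
  then show ?thesis
    by (rule eventually_mono[OF eventually_gt_at_top[of m]])
qed

lemma supported_zone: "supported s t zone"
  by (simp add: supported_def)

lemma zmult_eq_sum:
  assumes "finite K" "{k. g i k \<noteq> 0} \<subseteq> K"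
  shows "(g \<odot> h) i j = (\<Sum>k\<in>K. g i k * h k j)"
  unfolding zmult_def using assms by (intro sum.mono_neutral_left) auto

text \<open>Over a common square the product is a finite matrix product, whatever the supports of the rows are.\<close>

lemma zmult_supported:
  assumes "supported s t g"
  shows "(g \<odot> h) i j = (if s < i \<and> i \<le> t then \<Sum>k\<in>{s<..t}. g i k * h k j else h i j)"
proof (cases "s < i \<and> i \<le> t")
  case True
  then have "{k. g i k \<noteq> 0} \<subseteq> {s<..t}"
    using assms supportedD[OF assms, of i] by (force simp: zone_def split: if_splits)
  then show ?thesis using True by (simp add: zmult_eq_sum[of "{s<..t}"])
next
  case False
  then have *: "g i k = zone i k" for k
    using supportedD[OF assms, of i k] by auto
  then have "{k. g i k \<noteq> 0} \<subseteq> {i}"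
    by (auto simp: zone_def)
  then show ?thesis using False * by (subst zmult_eq_sum[of "{i}"]) auto
qed

lemma supported_zmult:
  assumes "supported s t g" "supported s t h"
  shows "supported s t (g \<odot> h)"
  unfolding supported_def
proof (intro allI impI)
  fix i j assume out: "\<not> (s < i \<and> i \<le> t \<and> s < j \<and> j \<le> t)"
  show "(g \<odot> h) i j = zone i j"
  proof (cases "s < i \<and> i \<le> t")
    case True
    then have "(g \<odot> h) i j = (\<Sum>k\<in>{s<..t}. g i k * h k j)"
      by (simp add: zmult_supported[OF assms(1)])
    also have "\<dots> = 0"
      using True out supportedD[OF assms(2), of _ j]
      by (intro sum.neutral) (auto simp: zone_def)
    finally show ?thesis using True out by (auto simp: zone_def)
  next
    case False
    then show ?thesis
      using supportedD[OF assms(2), of i j] zmult_supported[OF assms(1), of h i j] by auto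
  qed
qed

lemma finitary_zmult:
  assumes "finitary g" "finitary h"
  shows "finitary (g \<odot> h)"
proof -
  have "eventually (\<lambda>n. supported (- n) n g \<and> supported (- n) n h) at_top"
    using assms by (simp add: eventually_supported eventually_conj_iff)
  then obtain n where "supported (- n) n g" "supported (- n) n h"
    using eventually_happens by fastforce
  then show ?thesis
    by (blast intro: finitary_supported supported_zmult)
qed

lemma zmult_assoc:
  assumes "finitary g" "finitary h"
  shows "g \<odot> h \<odot> f = g \<odot> (h \<odot> f)"
proof -
  have "eventually (\<lambda>n. supported (- n) n g \<and> supported (- n) n h) at_top"
    using assms by (simp add: eventually_supported eventually_conj_iff)
  then obtain n where g: "supported (- n) n g" and h: "supported (- n) n h"
    using eventually_happens by fastforce
  note gh = supported_zmult[OF g h]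
  show ?thesis
  proof (intro ext)
    fix i j
    show "(g \<odot> h \<odot> f) i j = (g \<odot> (h \<odot> f)) i j"
    proof (cases "- n < i \<and> i \<le> n")
      case True
      let ?I = "{- n<..n}"
      have "(g \<odot> h \<odot> f) i j = (\<Sum>k\<in>?I. (\<Sum>l\<in>?I. g i l * h l k) * f k j)"
        using True by (simp add: zmult_supported[OF gh] zmult_supported[OF g])
      also have "\<dots> = (\<Sum>l\<in>?I. \<Sum>k\<in>?I. g i l * (h l k * f k j))"
        by (subst sum.swap) (simp add: sum_distrib_right mult.assoc)
      also have "\<dots> = (\<Sum>l\<in>?I. g i l * (h \<odot> f) l j)"
        by (intro sum.cong) (auto simp: zmult_supported[OF h] sum_distrib_left)
      also have "\<dots> = (g \<odot> (h \<odot> f)) i j"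
        using True by (simp add: zmult_supported[OF g])
      finally show ?thesis .
    next
      case False
      then show ?thesis
        by (auto simp: zmult_supported[OF gh] zmult_supported[OF g] zmult_supported[OF h])
    qed
  qed
qed

lemma zone_zmult [simp]: "zone \<odot> g = g"
  by (intro ext) (auto simp: zmult_supported[OF supported_zone[of 0 0]])

lemma zmult_zone [simp]:
  assumes "finitary g"
  shows "g \<odot> zone = g"
proof -
  have "(g \<odot> zone) i j = g i j" for i j
  proof -
    obtain n where n: "supported (- n) n g"
      using eventually_happens[OF eventually_supported[OF assms]] by fastforce
    have "(\<Sum>k\<in>{- n<..n}. g i k * zone k j) = (\<Sum>k\<in>{- n<..n}. if k = j then g i k else 0)"
      by (intro sum.cong) (auto simp: zone_def)
    then show ?thesis
      using supportedD[OF n, of i j] by (auto simp: zmult_supported[OF n])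
  qed
  then show ?thesis by blast
qed


section \<open>The group of invertible finitary matrices\<close>

definition ginv :: "'a::comm_ring_1 zmat \<Rightarrow> 'a zmat" where
  "ginv g = (SOME h. finitary h \<and> g \<odot> h = zone \<and> h \<odot> g = zone)"

lemma finitary_GL: "g \<in> GL \<Longrightarrow> finitary g"
  by (simp add: GL_def)

lemma ginv:
  assumes "g \<in> GL"
  shows finitary_ginv: "finitary (ginv g)" and ginv_right [simp]: "g \<odot> ginv g = zone"
    and ginv_left [simp]: "ginv g \<odot> g = zone"
proof -
  have "\<exists>h. finitary h \<and> g \<odot> h = zone \<and> h \<odot> g = zone"
    using assms by (simp add: GL_def)
  from someI_ex[OF this] show "finitary (ginv g)" "g \<odot> ginv g = zone" "ginv g \<odot> g = zone"
    by (auto simp: ginv_def)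
qed

lemma ginv_GL [simp]: "g \<in> GL \<Longrightarrow> ginv g \<in> GL"
  using finitary_ginv ginv_left ginv_right by (fastforce simp: GL_def)

lemma GL_assoc: "g \<in> GL \<Longrightarrow> h \<in> GL \<Longrightarrow> g \<odot> h \<odot> f = g \<odot> (h \<odot> f)"
  by (simp add: zmult_assoc finitary_GL)

lemma ginv_cancel [simp]:
  assumes "g \<in> GL"
  shows "ginv g \<odot> (g \<odot> f) = f" "g \<odot> (ginv g \<odot> f) = f"
  using assms by (simp_all flip: GL_assoc)

lemma zmult_zone_GL: "g \<in> GL \<Longrightarrow> g \<odot> zone = g"
  by (simp add: finitary_GL)

lemma GL_zmult [simp]:
  assumes "g \<in> GL" "h \<in> GL"
  shows "g \<odot> h \<in> GL"
proof -
  have 1: "g \<odot> h \<odot> (ginv h \<odot> ginv g) = zone"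
    using assms by (simp add: GL_assoc)
  have 2: "ginv h \<odot> ginv g \<odot> (g \<odot> h) = zone"
    using assms by (simp add: GL_assoc)
  have "finitary (g \<odot> h)" "finitary (ginv h \<odot> ginv g)"
    using assms by (auto intro: finitary_zmult finitary_GL finitary_ginv)
  with 1 2 show ?thesis unfolding GL_def by blast
qed

lemma zmult_conjugate: "E \<in> GL \<Longrightarrow> x \<in> GL \<Longrightarrow> E \<odot> (ginv E \<odot> x \<odot> E) = x \<odot> E"
  by (simp add: GL_assoc)

lemma ginv_ginv:
  assumes "g \<in> GL"
  shows "ginv (ginv g) = g"
proof -
  have "ginv (ginv g) \<odot> (ginv g \<odot> g) = g"
    using assms by (intro ginv_cancel(1) ginv_GL)
  then show ?thesis using assms by (simp add: zmult_zone_GL)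
qed

lemma zone_GL [simp]: "zone \<in> GL"
  using finitary_supported[OF supported_zone] by (auto simp: GL_def intro!: exI[of _ zone])

text \<open>Outside the square the rows of \<open>g\<close> are unit vectors, and comparing with \<open>g \<odot> ginv g = zone\<close> gives the
  rows of the inverse; the columns follow in the same way from \<open>ginv g \<odot> g = zone\<close>.\<close>

lemma supported_ginv:
  assumes "g \<in> GL" "supported s t g"
  shows "supported s t (ginv g)"
proof -
  let ?h = "ginv g"
  obtain s' t' where st': "s' \<le> s" "t \<le> t'" "supported s' t' ?h"
  proof -
    have "eventually (\<lambda>n. supported (- n) n ?h \<and> - s \<le> n \<and> t \<le> n) at_top"
      using finitary_ginv[OF assms(1)]
      by (simp add: eventually_supported eventually_conj_iff eventually_ge_at_top)
    then obtain n where "supported (- n) n ?h" "- s \<le> n" "t \<le> n"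
      using eventually_happens by fastforce
    then show ?thesis by (intro that[of "- n" n]) auto
  qed
  have rows: "?h i j = zone i j" if "\<not> (s < i \<and> i \<le> t)" for i j
    using fun_cong[OF fun_cong[OF ginv_right[OF assms(1)]], of i j] that
    by (auto simp: zmult_supported[OF assms(2)] split: if_splits)
  have cols: "?h i j = zone i j" if "\<not> (s < j \<and> j \<le> t)" for i j
  proof (cases "s' < i \<and> i \<le> t' \<and> s' < j \<and> j \<le> t'")
    case True
    have "zone i j = (?h \<odot> g) i j" using assms by simp
    also have "\<dots> = (\<Sum>k\<in>{s'<..t'}. ?h i k * g k j)"
      using True by (simp add: zmult_supported[OF st'(3)])
    also have "\<dots> = (\<Sum>k\<in>{s'<..t'}. if k = j then ?h i k else 0)"
      using supportedD[OF assms(2), of _ j] that by (intro sum.cong) (auto simp: zone_def)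
    also have "\<dots> = ?h i j" using True by simp
    finally show ?thesis ..
  qed (use supportedD[OF st'(3)] in auto)
  from rows cols show ?thesis by (auto simp: supported_def)
qed


section \<open>The subgroups of the decomposition\<close>

lemma IvalsE:
  assumes "\<alpha> \<in> Ivals"
  obtains l u where "\<alpha> = (l, u)" "l \<le> u"
  using assms by (auto simp: Ivals_def)

text \<open>The four block conditions in the definition amount to one: in the rows of the last two groups, \<open>g\<close> agrees with
  the identity in the columns of the first two groups. As operators, the elements of \<open>Q \<alpha>\<close> move the vectors
  supported on \<open>j \<le> snd \<alpha>\<close> only by vectors supported on \<open>j \<le> fst \<alpha>\<close>.\<close>

lemma Q_iff:
  assumes "\<alpha> \<in> Ivals"
  shows "g \<in> Q \<alpha> \<longleftrightarrow> g \<in> GL \<and> (\<forall>i j. fst \<alpha> < i \<longrightarrow> j \<le> snd \<alpha> \<longrightarrow> g i j = zone i j)"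
proof -
  obtain l u where \<alpha>: "\<alpha> = (l, u)" "l \<le> u" using assms by (rule IvalsE)
  have "(\<forall>i j. l < i \<longrightarrow> j \<le> u \<longrightarrow> g i j = zone i j) \<longleftrightarrow>
     (\<forall>i j. l < i \<and> i \<le> u \<and> j \<le> l \<longrightarrow> g i j = 0) \<and>
     (\<forall>i j. l < i \<and> i \<le> u \<and> l < j \<and> j \<le> u \<longrightarrow> g i j = zone i j) \<and>
     (\<forall>i j. u < i \<and> j \<le> l \<longrightarrow> g i j = 0) \<and>
     (\<forall>i j. u < i \<and> l < j \<and> j \<le> u \<longrightarrow> g i j = 0)" (is "?L \<longleftrightarrow> ?R")
  proof
    assume ?L
    then show ?R using \<alpha> by auto
  next
    assume R: ?R
    show ?L
    proof (intro allI impI)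
      fix i j assume "l < i" "j \<le> u"
      then show "g i j = zone i j"
        using R \<alpha> by (cases "i \<le> u"; cases "j \<le> l") auto
    qed
  qed
  then show ?thesis by (simp add: Q_def \<alpha>)
qed

lemma Q_GL: "g \<in> Q \<alpha> \<Longrightarrow> g \<in> GL"
  by (simp add: Q_def)

text \<open>Enlarging the middle group at both ends strengthens the condition of \<open>Q_iff\<close>.\<close>

lemma Q_mono:
  assumes "g \<in> Q (s, t)" "\<alpha> \<in> Ivals" "s \<le> fst \<alpha>" "snd \<alpha> \<le> t"
  shows "g \<in> Q \<alpha>"
proof -
  have "(s, t) \<in> Ivals" using assms by (auto simp: Ivals_def)
  with assms show ?thesis by (simp add: Q_iff)
qed

lemma zone_Q [simp]: "\<alpha> \<in> Ivals \<Longrightarrow> zone \<in> Q \<alpha>"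
  by (simp add: Q_iff Ivals_def)

lemma Q_zmult:
  assumes \<alpha>: "\<alpha> \<in> Ivals" and g: "g \<in> Q \<alpha>" and h: "h \<in> Q \<alpha>"
  shows "g \<odot> h \<in> Q \<alpha>"
proof -
  have gD: "g i j = zone i j" if "fst \<alpha> < i" "j \<le> snd \<alpha>" for i j
    using g that by (simp add: Q_iff[OF \<alpha>])
  have hD: "h i j = zone i j" if "fst \<alpha> < i" "j \<le> snd \<alpha>" for i j
    using h that by (simp add: Q_iff[OF \<alpha>])
  have \<alpha>le: "fst \<alpha> \<le> snd \<alpha>" using \<alpha> by (auto simp: Ivals_def)
  obtain n where n: "supported (- n) n g"
    using eventually_happens[OF eventually_supported[OF finitary_GL[OF Q_GL[OF g]]]] by fastforce
  have "(g \<odot> h) i j = zone i j" if ij: "fst \<alpha> < i" "j \<le> snd \<alpha>" for i j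
  proof (cases "- n < i \<and> i \<le> n")
    case True
    have "(g \<odot> h) i j = (\<Sum>k\<in>{- n<..n}. g i k * h k j)"
      using True by (simp add: zmult_supported[OF n])
    also have "\<dots> = (\<Sum>k\<in>{- n<..n}. if k = i then zone i j else 0)"
    proof (intro sum.cong refl)
      fix k
      show "g i k * h k j = (if k = i then zone i j else 0)"
      proof (cases "fst \<alpha> < k")
        case True
        then have "h k j = zone k j" using hD ij by simp
        then show ?thesis
          using gD[of i k] gD[of i j] ij by (auto simp: zone_def split: if_splits)
      next
        case False
        then have "g i k = 0" using gD[of i k] ij \<alpha>le by auto
        then show ?thesis using False ij by auto
      qed
    qed
    also have "\<dots> = zone i j" using True by simp
    finally show ?thesis .
  next
    case False
    then show ?thesis using hD ij by (auto simp: zmult_supported[OF n])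
  qed
  then show ?thesis using g h by (simp add: Q_iff[OF \<alpha>])
qed

text \<open>From \<open>det A * det B = 1\<close> the adjugate of \<open>A\<close>, scaled by \<open>det B\<close>, is a right inverse of \<open>A\<close>, and a left and a
  right inverse coincide.\<close>

lemma mat_left_inverse_imp_right_inverse:
  fixes A B :: "'a::comm_ring_1 mat"
  assumes A: "A \<in> carrier_mat n n" and B: "B \<in> carrier_mat n n" and BA: "B * A = 1\<^sub>m n"
  shows "A * B = 1\<^sub>m n"
proof -
  have det: "det A * det B = 1"
    using det_mult[OF B A] BA by (simp add: mult.commute)
  define C where "C = det B \<cdot>\<^sub>m adj_mat A"
  have C: "C \<in> carrier_mat n n" using adj_mat(1)[OF A] by (simp add: C_def)
  have AC: "A * C = 1\<^sub>m n"
    unfolding C_def mult_smult_distrib[OF A adj_mat(1)[OF A]] adj_mat(2)[OF A]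
    using det by (intro eq_matI) (auto simp: mult.commute)
  have "B = B * (A * C)" using B by (simp add: AC)
  also have "\<dots> = C" using A B C BA by (simp flip: assoc_mult_mat)
  finally show ?thesis using AC by simp
qed

text \<open>Write \<open>g\<close> and its inverse \<open>h\<close> as two by two block matrices with a cut at \<open>l\<close>. The upper left block
  of \<open>h \<odot> g = zone\<close> says that the block \<open>h11\<close> is a left inverse of \<open>g11\<close>, hence also a right inverse. The
  lower left block says \<open>h21 g11 = 0\<close>; multiplying by \<open>h11\<close> from the right gives \<open>h21 = 0\<close>.\<close>

lemma ginv_block_triangular:
  assumes g: "g \<in> GL" and tri: "\<And>i j. l < i \<Longrightarrow> j \<le> l \<Longrightarrow> g i j = 0"
    and ij: "l < i" "j \<le> l"
  shows "ginv g i j = 0"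
proof -
  let ?h = "ginv g"
  obtain s t where st: "s \<le> l" "l \<le> t" and sg: "supported s t g"
  proof -
    have "eventually (\<lambda>n. supported (- n) n g \<and> - l \<le> n \<and> l \<le> n) at_top"
      using finitary_GL[OF g]
      by (simp add: eventually_supported eventually_conj_iff eventually_ge_at_top)
    then obtain n where "supported (- n) n g" "- l \<le> n" "l \<le> n"
      using eventually_happens by fastforce
    then show ?thesis by (intro that[of "- n" n]) auto
  qed
  have sh: "supported s t ?h" by (rule supported_ginv[OF g sg])
  let ?K = "{s<..l}"
  have left: "(\<Sum>k\<in>?K. ?h i k * g k j) = zone i j" if "s < i" "i \<le> t" "s < j" "j \<le> l" for i j
  proof -
    have "zone i j = (?h \<odot> g) i j" using g by simp
    also have "\<dots> = (\<Sum>k\<in>{s<..t}. ?h i k * g k j)"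
      using that by (simp add: zmult_supported[OF sh])
    also have "\<dots> = (\<Sum>k\<in>?K. ?h i k * g k j)"
      using st that tri by (intro sum.mono_neutral_right) auto
    finally show ?thesis ..
  qed
  have right: "(\<Sum>k\<in>?K. g i k * ?h k j) = zone i j" if "i \<in> ?K" "j \<in> ?K" for i j
  proof -
    define n where "n = nat (l - s)"
    define X where "X f = mat n n (\<lambda>(a, b). f (s + 1 + int a) (s + 1 + int b))" for f :: "'a zmat"
    have carr: "X f \<in> carrier_mat n n" for f by (simp add: X_def)
    have sum_K: "(\<Sum>k\<in>?K. f k) = (\<Sum>c<n. f (s + 1 + int c))" for f :: "int \<Rightarrow> 'a"
      by (rule sum.reindex_bij_witness[of _ "\<lambda>c. s + 1 + int c" "\<lambda>k. nat (k - s - 1)"])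
        (auto simp: n_def)
    have X_mult: "X f * X f' = 1\<^sub>m n \<longleftrightarrow>
      (\<forall>a<n. \<forall>b<n. (\<Sum>k\<in>?K. f (s + 1 + int a) k * f' k (s + 1 + int b)) = zone (s + 1 + int a) (s + 1 + int b))"
      for f f'
      by (auto simp: X_def mat_eq_iff scalar_prod_def sum_K zone_def atLeast0LessThan)
    have "X ?h * X g = 1\<^sub>m n"
      unfolding X_mult using st by (auto simp: n_def intro!: left)
    then have "X g * X ?h = 1\<^sub>m n"
      by (rule mat_left_inverse_imp_right_inverse[OF carr carr])
    then have "(\<Sum>k\<in>?K. g (s + 1 + int (nat (i - s - 1))) k * ?h k (s + 1 + int (nat (j - s - 1))))
        = zone (s + 1 + int (nat (i - s - 1))) (s + 1 + int (nat (j - s - 1)))"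
      using that unfolding X_mult
      by (elim allE[of _ "nat (i - s - 1)"] impE allE[of _ "nat (j - s - 1)"]) (auto simp: n_def)
    then show ?thesis using that by simp
  qed
  show ?thesis
  proof (cases "s < j \<and> i \<le> t")
    case True
    \<comment> \<open>Insert \<open>zone = g11 h11\<close> and use \<open>h21 g11 = 0\<close>.\<close>
    have "(\<Sum>k\<in>?K. ?h i k * zone k j) = (\<Sum>k\<in>?K. if k = j then ?h i k else 0)"
      by (intro sum.cong) (auto simp: zone_def)
    then have "?h i j = (\<Sum>k\<in>?K. ?h i k * zone k j)"
      using True ij by simp
    also have "\<dots> = (\<Sum>k\<in>?K. \<Sum>m\<in>?K. ?h i k * (g k m * ?h m j))"
      using True ij by (intro sum.cong) (auto simp: right simp flip: sum_distrib_left)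
    also have "\<dots> = (\<Sum>m\<in>?K. (\<Sum>k\<in>?K. ?h i k * g k m) * ?h m j)"
      by (subst sum.swap) (simp add: sum_distrib_right mult.assoc)
    also have "\<dots> = 0"
      using True ij st left by (intro sum.neutral) (auto simp: zone_def)
    finally show ?thesis .
  next
    case False
    then show ?thesis using ij supportedD[OF sh, of i j] by auto
  qed
qed

text \<open>For \<open>j \<le> snd \<alpha>\<close> the \<open>j\<close>th column of \<open>g\<close> differs from the unit vector only on the first group. The
  inverse preserves vectors supported on the first group, so its \<open>j\<close>th column has the same property.\<close>

lemma ginv_Q:
  assumes \<alpha>: "\<alpha> \<in> Ivals" and gQ: "g \<in> Q \<alpha>"
  shows "ginv g \<in> Q \<alpha>"
proof -
  have g: "g \<in> GL" by (rule Q_GL[OF gQ])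
  have gD: "g i j = zone i j" if "fst \<alpha> < i" "j \<le> snd \<alpha>" for i j
    using gQ that by (simp add: Q_iff[OF \<alpha>])
  have \<alpha>le: "fst \<alpha> \<le> snd \<alpha>" using \<alpha> by (auto simp: Ivals_def)
  have tri: "ginv g i j = 0" if "fst \<alpha> < i" "j \<le> fst \<alpha>" for i j
    using \<alpha>le that gD by (intro ginv_block_triangular[OF g, of "fst \<alpha>"]) auto
  obtain n where n: "supported (- n) n (ginv g)"
    using eventually_happens[OF eventually_supported[OF finitary_ginv[OF g]]] by fastforce
  have "ginv g i j = zone i j" if ij: "fst \<alpha> < i" "j \<le> snd \<alpha>" for i j
  proof (cases "- n < i \<and> i \<le> n \<and> - n < j \<and> j \<le> n")
    case True
    have "zone i j = (ginv g \<odot> g) i j" using g by simp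
    also have "\<dots> = (\<Sum>k\<in>{- n<..n}. ginv g i k * g k j)"
      using True by (simp add: zmult_supported[OF n])
    also have "\<dots> = (\<Sum>k\<in>{- n<..n}. if k = j then ginv g i k else 0)"
    proof (intro sum.cong refl)
      fix k
      show "ginv g i k * g k j = (if k = j then ginv g i k else 0)"
        using tri[of i k] gD[of k j] ij by (cases "fst \<alpha> < k") (auto simp: zone_def)
    qed
    also have "\<dots> = ginv g i j" using True by simp
    finally show ?thesis ..
  next
    case False
    then show ?thesis using supportedD[OF n] by blast
  qed
  then show ?thesis using g by (simp add: Q_iff[OF \<alpha>])
qed

text \<open>An element of \<open>Q (s, t)\<close> moves the vectors supported on \<open>j \<le> t\<close> by vectors supported on \<open>j \<le> s\<close>. The matrix
  \<open>B\<close> preserves the first space and acts as the identity on the second.\<close>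

lemma conjugate_Q_supported:
  assumes B: "B \<in> GL" "supported s t B" and st: "s \<le> t" and q: "q \<in> Q (s, t)"
  shows "ginv B \<odot> q \<odot> B \<in> Q (s, t)"
proof -
  have I: "(s, t) \<in> Ivals" using st by (simp add: Ivals_def)
  have qGL: "q \<in> GL" by (rule Q_GL[OF q])
  obtain n where n: "supported (- n) n q"
    using eventually_happens[OF eventually_supported[OF finitary_GL[OF qGL]]] by fastforce
  have qB: "(q \<odot> B) k j = B k j" if kj: "s < k" "j \<le> t" for k j
  proof (cases "- n < k \<and> k \<le> n")
    case True
    have "(q \<odot> B) k j = (\<Sum>m\<in>{- n<..n}. q k m * B m j)"
      using True by (simp add: zmult_supported[OF n])
    also have "\<dots> = (\<Sum>m\<in>{- n<..n}. if m = k then B k j else 0)"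
    proof (intro sum.cong refl)
      fix m
      show "q k m * B m j = (if m = k then B k j else 0)"
      proof (cases "m \<le> t")
        case True
        then show ?thesis using q kj by (simp add: Q_iff[OF I] zone_def)
      next
        case False
        then have "B m j = 0" using supportedD[OF B(2), of m j] kj by auto
        then show ?thesis by auto
      qed
    qed
    also have "\<dots> = B k j" using True by simp
    finally show ?thesis .
  qed (auto simp: zmult_supported[OF n])
  note si = supported_ginv[OF B]
  have "(ginv B \<odot> (q \<odot> B)) i j = zone i j" if ij: "s < i" "j \<le> t" for i j
  proof -
    have "(ginv B \<odot> (q \<odot> B)) i j = (ginv B \<odot> B) i j"
      using ij by (auto simp: zmult_supported[OF si] qB intro!: sum.cong)
    then show ?thesis using B by simp
  qed
  then show ?thesis using B qGL by (simp add: Q_iff[OF I] GL_assoc)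
qed

section \<open>Permutation matrices\<close>

definition perm_mat :: "(int \<Rightarrow> int) \<Rightarrow> 'a::comm_ring_1 zmat" where
  "perm_mat \<sigma> = (\<lambda>i j. if i = \<sigma> j then 1 else 0)"

text \<open>The permutations whose matrices are block diagonal for \<open>\<beta>\<close> with the identity in the middle. The
  lower triangular blocks vanish as well as the upper ones, so one such matrix can lie in \<open>Q \<epsilon>\<close> for several \<open>\<epsilon>\<close>.\<close>

definition block_perm :: "int \<times> int \<Rightarrow> (int \<Rightarrow> int) \<Rightarrow> bool" where
  "block_perm \<beta> \<sigma> \<longleftrightarrow> bij \<sigma> \<and> finite {x. \<sigma> x \<noteq> x} \<and>
     (\<forall>x. \<sigma> x \<le> fst \<beta> \<longleftrightarrow> x \<le> fst \<beta>) \<and> (\<forall>x. snd \<beta> < \<sigma> x \<longleftrightarrow> snd \<beta> < x) \<and>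
     (\<forall>x. fst \<beta> < x \<and> x \<le> snd \<beta> \<longrightarrow> \<sigma> x = x)"

lemma block_permD:
  assumes "block_perm \<beta> \<sigma>"
  shows "bij \<sigma>" "\<sigma> x \<le> fst \<beta> \<longleftrightarrow> x \<le> fst \<beta>" "snd \<beta> < \<sigma> x \<longleftrightarrow> snd \<beta> < x"
    "fst \<beta> < x \<Longrightarrow> x \<le> snd \<beta> \<Longrightarrow> \<sigma> x = x"
  using assms by (auto simp: block_perm_def)

lemma block_perm_inv_simps [simp]:
  assumes "block_perm \<beta> \<sigma>"
  shows "\<sigma> (inv \<sigma> x) = x" "inv \<sigma> (\<sigma> x) = x" "inv (inv \<sigma>) = \<sigma>"
  using block_permD(1)[OF assms]
  by (simp_all add: bij_is_surj surj_f_inv_f bij_is_inj inv_inv_eq)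

lemma block_perm_inv [simp]:
  assumes "block_perm \<beta> \<sigma>"
  shows "block_perm \<beta> (inv \<sigma>)"
proof -
  have eq: "inv \<sigma> x = x \<longleftrightarrow> \<sigma> x = x" for x
    using assms by (metis block_perm_inv_simps(1,2))
  have "inv \<sigma> x \<le> fst \<beta> \<longleftrightarrow> x \<le> fst \<beta>" "snd \<beta> < inv \<sigma> x \<longleftrightarrow> snd \<beta> < x" for x
    using block_permD(2,3)[OF assms, of "inv \<sigma> x"] assms by simp_all
  then show ?thesis
    using assms by (auto simp: block_perm_def eq bij_imp_bij_inv)
qed

lemma block_perm_comp [simp]:
  assumes "block_perm \<beta> \<sigma>" "block_perm \<beta> \<tau>"
  shows "block_perm \<beta> (\<sigma> \<circ> \<tau>)"
proof -
  have "{x. (\<sigma> \<circ> \<tau>) x \<noteq> x} \<subseteq> {x. \<sigma> x \<noteq> x} \<union> {x. \<tau> x \<noteq> x}" by auto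
  then have "finite {x. (\<sigma> \<circ> \<tau>) x \<noteq> x}"
    using assms by (auto simp: block_perm_def intro: finite_subset)
  then show ?thesis
    using assms by (auto simp: block_perm_def intro!: bij_comp)
qed

lemma block_perm_mono:
  assumes "block_perm (s, t) \<sigma>" "\<beta> \<in> Ivals" "s \<le> fst \<beta>" "snd \<beta> \<le> t"
  shows "block_perm \<beta> \<sigma>"
proof -
  note D = block_permD[OF assms(1), simplified]
  have cases: "\<sigma> x = x \<or> x \<le> s \<and> \<sigma> x \<le> s \<or> t < x \<and> t < \<sigma> x" for x
    using D(2)[of x] D(3)[of x] D(4)[of x] by linarith
  have "(\<sigma> x \<le> fst \<beta> \<longleftrightarrow> x \<le> fst \<beta>) \<and> (snd \<beta> < \<sigma> x \<longleftrightarrow> snd \<beta> < x) \<and>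
    (fst \<beta> < x \<and> x \<le> snd \<beta> \<longrightarrow> \<sigma> x = x)" for x
    using cases[of x] assms(2-4) by (auto simp: Ivals_def)
  then show ?thesis
    using assms(1) by (simp add: block_perm_def)
qed

text \<open>An index outside \<open>(s, t]\<close> cannot be moved across this interval: it stays on its side of \<open>\<beta>\<close>, and the values
  in \<open>(s, t]\<close> are taken by fixed points.\<close>

lemma block_perm_restrict:
  assumes "block_perm \<beta> \<sigma>" "\<And>x. s < x \<Longrightarrow> x \<le> t \<Longrightarrow> \<sigma> x = x"
    and "s \<le> fst \<beta>" "fst \<beta> \<le> snd \<beta>" "snd \<beta> \<le> t"
  shows "block_perm (s, t) \<sigma>"
proof -
  note D = block_permD[OF assms(1)]
  have inj: "\<sigma> x = x" if "\<sigma> (\<sigma> x) = \<sigma> x" for x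
    using that D(1) by (metis bij_pointE)
  have "\<sigma> x \<le> s \<longleftrightarrow> x \<le> s" "t < \<sigma> x \<longleftrightarrow> t < x" for x
    using D(2)[of x] D(3)[of x] assms(2)[of x] assms(2)[of "\<sigma> x"] inj[of x] assms(3-5)
    by linarith+
  then show ?thesis
    using assms(1,2) by (simp add: block_perm_def)
qed

lemma finitary_perm_mat:
  assumes "finite {x. \<sigma> x \<noteq> x}"
  shows "finitary (perm_mat \<sigma> :: 'a::comm_ring_1 zmat)"
proof -
  let ?S = "{x. \<sigma> x \<noteq> x}"
  have "{(i, j). (perm_mat \<sigma> :: 'a zmat) i j - zone i j \<noteq> 0} \<subseteq> (\<lambda>x. (\<sigma> x, x)) ` ?S \<union> (\<lambda>x. (x, x)) ` ?S"
    by (auto simp: perm_mat_def zone_def split: if_splits)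
  then show ?thesis
    unfolding finitary_def using assms by (auto intro: finite_subset)
qed

lemma perm_mat_zmult:
  assumes "bij \<sigma>"
  shows "(perm_mat \<sigma> \<odot> g) i j = g (inv \<sigma> i) j"
proof -
  have "i = \<sigma> k \<longleftrightarrow> k = inv \<sigma> i" for k
    using assms by (metis bij_inv_eq_iff)
  then show ?thesis
    by (subst zmult_eq_sum[of "{inv \<sigma> i}"]) (auto simp: perm_mat_def)
qed

lemma zmult_perm_mat:
  assumes "finitary g"
  shows "(g \<odot> perm_mat \<sigma>) i j = g i (\<sigma> j)"
proof -
  obtain n where n: "supported (- n) n g"
    using eventually_happens[OF eventually_supported[OF assms]] by fastforce
  have "g i k = 0" if "k \<notin> insert i {- n<..n}" for k
    using supportedD[OF n, of i k] that by auto
  then have "{k. g i k \<noteq> 0} \<subseteq> insert i {- n<..n}" by blast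
  then have "(g \<odot> perm_mat \<sigma>) i j = (\<Sum>k\<in>insert i {- n<..n}. g i k * perm_mat \<sigma> k j)"
    by (intro zmult_eq_sum) auto
  also have "\<dots> = (\<Sum>k\<in>insert i {- n<..n}. if k = \<sigma> j then g i k else 0)"
    by (intro sum.cong) (auto simp: perm_mat_def)
  also have "\<dots> = g i (\<sigma> j)"
    using supportedD[OF n, of i "\<sigma> j"] by (auto simp: zone_def simp del: sum.insert_if)
  finally show ?thesis .
qed

lemma perm_mat_comp:
  assumes "bij \<sigma>"
  shows "perm_mat \<sigma> \<odot> perm_mat \<tau> = perm_mat (\<sigma> \<circ> \<tau>)"
proof (intro ext)
  fix i j
  have "inv \<sigma> i = \<tau> j \<longleftrightarrow> i = \<sigma> (\<tau> j)"
    using assms by (metis bij_inv_eq_iff)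
  then show "(perm_mat \<sigma> \<odot> perm_mat \<tau>) i j = perm_mat (\<sigma> \<circ> \<tau>) i j"
    unfolding perm_mat_zmult[OF assms] by (simp add: perm_mat_def)
qed

lemma perm_mat_id: "perm_mat id = zone"
  by (simp add: perm_mat_def zone_def)

lemma perm_mat_inv:
  assumes "block_perm \<beta> \<sigma>"
  shows "perm_mat \<sigma> \<odot> perm_mat (inv \<sigma>) = zone" "perm_mat (inv \<sigma>) \<odot> perm_mat \<sigma> = zone"
proof -
  have "\<sigma> \<circ> inv \<sigma> = id" "inv \<sigma> \<circ> \<sigma> = id"
    using assms by (auto simp: fun_eq_iff)
  then show "perm_mat \<sigma> \<odot> perm_mat (inv \<sigma>) = zone" "perm_mat (inv \<sigma>) \<odot> perm_mat \<sigma> = zone"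
    using assms block_permD(1)[OF assms] block_permD(1)[OF block_perm_inv[OF assms]]
    by (simp_all add: perm_mat_comp perm_mat_id)
qed

lemma perm_mat_GL:
  assumes "block_perm \<beta> \<sigma>"
  shows "perm_mat \<sigma> \<in> GL"
  using perm_mat_inv[OF assms] assms block_perm_inv[OF assms]
  unfolding GL_def block_perm_def by (blast intro: finitary_perm_mat)

lemma perm_mat_cancel:
  assumes "block_perm \<beta> \<sigma>"
  shows "perm_mat \<sigma> \<odot> (perm_mat (inv \<sigma>) \<odot> f) = f" "perm_mat (inv \<sigma>) \<odot> (perm_mat \<sigma> \<odot> f) = f"
  by (simp_all add: perm_mat_inv[OF assms] perm_mat_GL[OF assms]
      perm_mat_GL[OF block_perm_inv[OF assms]] flip: GL_assoc)

lemma perm_mat_Q: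
  assumes "\<beta> \<in> Ivals" "block_perm \<beta> \<sigma>"
  shows "(perm_mat \<sigma> :: 'a::comm_ring_1 zmat) \<in> Q \<beta>"
proof -
  have "(perm_mat \<sigma> :: 'a zmat) i j = zone i j" if "fst \<beta> < i" "j \<le> snd \<beta>" for i j
    using block_permD(2-4)[OF assms(2), of j] that by (auto simp: perm_mat_def zone_def)
  then show ?thesis
    using perm_mat_GL[OF assms(2)] by (simp add: Q_iff[OF assms(1)])
qed

lemma perm_mat_conjugate:
  assumes "block_perm \<beta> \<sigma>" "g \<in> GL"
  shows "(perm_mat (inv \<sigma>) \<odot> g \<odot> perm_mat \<sigma>) i j = g (\<sigma> i) (\<sigma> j)"
proof -
  have "finitary (perm_mat (inv \<sigma>) \<odot> g)"
    using assms perm_mat_GL[OF block_perm_inv[OF assms(1)]] by (intro finitary_GL GL_zmult)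
  then show ?thesis
    using assms block_permD(1)[OF block_perm_inv[OF assms(1)]]
    by (simp add: zmult_perm_mat perm_mat_zmult)
qed

text \<open>The permutation and the matrix act on complementary sets of indices.\<close>

lemma perm_mat_commute:
  assumes "block_perm (s, t) \<sigma>" "A \<in> GL" "supported s t A"
  shows "perm_mat \<sigma> \<odot> A = A \<odot> perm_mat \<sigma>"
proof (intro ext)
  fix i j
  note D = block_permD[OF assms(1), simplified]
  have "A (inv \<sigma> i) j = A i (\<sigma> j)"
  proof (cases "s < i \<and> i \<le> t \<and> s < j \<and> j \<le> t")
    case True
    then show ?thesis
      using D(4)[of j] block_permD(4)[OF block_perm_inv[OF assms(1)], of i] by simp
  next
    case False
    have "A (inv \<sigma> i) j = zone (inv \<sigma> i) j"
      using False block_permD(2-4)[OF block_perm_inv[OF assms(1)], of i] by (intro supportedD[OF assms(3)]) auto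
    moreover have "A i (\<sigma> j) = zone i (\<sigma> j)"
      using False D(2-4)[of j] by (intro supportedD[OF assms(3)]) auto
    moreover have "inv \<sigma> i = j \<longleftrightarrow> i = \<sigma> j"
      using assms(1) by auto
    ultimately show ?thesis by (auto simp: zone_def)
  qed
  then show "(perm_mat \<sigma> \<odot> A) i j = (A \<odot> perm_mat \<sigma>) i j"
    using D(1) finitary_GL[OF assms(2)] by (simp add: perm_mat_zmult zmult_perm_mat)
qed


section \<open>Double cosets\<close>

lemma dcosetI: "p \<in> Q \<alpha> \<Longrightarrow> q \<in> Q \<beta> \<Longrightarrow> p \<odot> g \<odot> q \<in> dcoset \<alpha> \<beta> g"
  by (auto simp: dcoset_def)

lemma dcoset_self:
  assumes "\<alpha> \<in> Ivals" "\<beta> \<in> Ivals" "g \<in> GL"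
  shows "g \<in> dcoset \<alpha> \<beta> g"
  using dcosetI[of zone \<alpha> zone \<beta> g] assms by (simp add: zmult_zone_GL)

lemma dcoset_left:
  assumes "\<alpha> \<in> Ivals" "p \<in> Q \<alpha>" "g \<in> GL"
  shows "dcoset \<alpha> \<beta> (p \<odot> g) = dcoset \<alpha> \<beta> g"
proof
  have p: "p \<in> GL" by (rule Q_GL[OF assms(2)])
  show "dcoset \<alpha> \<beta> (p \<odot> g) \<subseteq> dcoset \<alpha> \<beta> g"
  proof
    fix h assume "h \<in> dcoset \<alpha> \<beta> (p \<odot> g)"
    then obtain p' q where q: "q \<in> Q \<beta>" and p': "p' \<in> Q \<alpha>" and h: "h = p' \<odot> (p \<odot> g) \<odot> q"
      by (auto simp: dcoset_def)
    have "h = (p' \<odot> p) \<odot> g \<odot> q" using h p assms Q_GL[OF p'] by (simp add: GL_assoc)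
    then show "h \<in> dcoset \<alpha> \<beta> g" using Q_zmult[OF assms(1) p' assms(2)] q by (simp add: dcosetI)
  qed
  show "dcoset \<alpha> \<beta> g \<subseteq> dcoset \<alpha> \<beta> (p \<odot> g)"
  proof
    fix h assume "h \<in> dcoset \<alpha> \<beta> g"
    then obtain p' q where q: "q \<in> Q \<beta>" and p': "p' \<in> Q \<alpha>" and h: "h = p' \<odot> g \<odot> q"
      by (auto simp: dcoset_def)
    have "h = (p' \<odot> ginv p) \<odot> (p \<odot> g) \<odot> q" using h p assms Q_GL[OF p'] by (simp add: GL_assoc)
    then show "h \<in> dcoset \<alpha> \<beta> (p \<odot> g)"
      using Q_zmult[OF assms(1) p' ginv_Q[OF assms(1,2)]] q by (simp add: dcosetI)
  qed
qed

lemma dcoset_right: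
  assumes "\<beta> \<in> Ivals" "q \<in> Q \<beta>" "g \<in> GL"
  shows "dcoset \<alpha> \<beta> (g \<odot> q) = dcoset \<alpha> \<beta> g"
proof
  have q: "q \<in> GL" by (rule Q_GL[OF assms(2)])
  show "dcoset \<alpha> \<beta> (g \<odot> q) \<subseteq> dcoset \<alpha> \<beta> g"
  proof
    fix h assume "h \<in> dcoset \<alpha> \<beta> (g \<odot> q)"
    then obtain p q' where q': "q' \<in> Q \<beta>" and p: "p \<in> Q \<alpha>" and h: "h = p \<odot> (g \<odot> q) \<odot> q'"
      by (auto simp: dcoset_def)
    have "h = p \<odot> g \<odot> (q \<odot> q')" using h q assms Q_GL[OF p] by (simp add: GL_assoc)
    then show "h \<in> dcoset \<alpha> \<beta> g" using Q_zmult[OF assms(1,2) q'] p by (simp add: dcosetI)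
  qed
  show "dcoset \<alpha> \<beta> g \<subseteq> dcoset \<alpha> \<beta> (g \<odot> q)"
  proof
    fix h assume "h \<in> dcoset \<alpha> \<beta> g"
    then obtain p q' where q': "q' \<in> Q \<beta>" and p: "p \<in> Q \<alpha>" and h: "h = p \<odot> g \<odot> q'"
      by (auto simp: dcoset_def)
    have "h = p \<odot> (g \<odot> q) \<odot> (ginv q \<odot> q')" using h q assms Q_GL[OF p] by (simp add: GL_assoc)
    then show "h \<in> dcoset \<alpha> \<beta> (g \<odot> q)"
      using Q_zmult[OF assms(1) ginv_Q[OF assms(1,2)] q'] p by (simp add: dcosetI)
  qed
qed

lemma dcoset_eq:
  assumes "\<alpha> \<in> Ivals" "\<beta> \<in> Ivals" "g \<in> GL" "h \<in> dcoset \<alpha> \<beta> g"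
  shows "h \<in> GL" "dcoset \<alpha> \<beta> h = dcoset \<alpha> \<beta> g"
proof -
  obtain p q where pq: "p \<in> Q \<alpha>" "q \<in> Q \<beta>" "h = p \<odot> g \<odot> q"
    using assms by (auto simp: dcoset_def)
  then have GL: "p \<in> GL" "q \<in> GL" by (auto dest: Q_GL)
  then show "h \<in> GL" using pq assms by simp
  show "dcoset \<alpha> \<beta> h = dcoset \<alpha> \<beta> g"
    using pq GL assms by (simp add: dcoset_left dcoset_right)
qed


section \<open>Separating permutations\<close>

text \<open>The square \<open>(s, t]\<close> is that of the left factor, \<open>(s', t']\<close> that of the right factor. Conjugated by \<open>\<sigma>\<close>, the
  right factor acts on indices that meet \<open>(s, t]\<close> only in \<open>\<beta>\<close>.\<close>

definition separates :: "int \<times> int \<Rightarrow> int \<Rightarrow> int \<Rightarrow> int \<Rightarrow> int \<Rightarrow> (int \<Rightarrow> int) \<Rightarrow> bool" where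
  "separates \<beta> s t s' t' \<sigma> \<longleftrightarrow> block_perm \<beta> \<sigma> \<and>
     (\<forall>x. s' < x \<and> x \<le> t' \<and> \<not> (fst \<beta> < x \<and> x \<le> snd \<beta>) \<longrightarrow> \<not> (s < \<sigma> x \<and> \<sigma> x \<le> t))"

text \<open>Exchanges the \<open>m\<close> indices just below the middle group with their translates by \<open>M\<close>, and the \<open>n\<close> indices
  just above it with their translates by \<open>N\<close>.\<close>

definition swap_outer :: "int \<times> int \<Rightarrow> int \<Rightarrow> int \<Rightarrow> int \<Rightarrow> int \<Rightarrow> int \<Rightarrow> int" where
  "swap_outer \<beta> m M n N x =
     (if fst \<beta> - m < x \<and> x \<le> fst \<beta> then x - M
      else if fst \<beta> - M - m < x \<and> x \<le> fst \<beta> - M then x + M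
      else if snd \<beta> < x \<and> x \<le> snd \<beta> + n then x + N
      else if snd \<beta> + N < x \<and> x \<le> snd \<beta> + N + n then x - N
      else x)"

lemma swap_outer_involution:
  assumes "\<beta> \<in> Ivals" "m \<le> M" "n \<le> N"
  shows "swap_outer \<beta> m M n N (swap_outer \<beta> m M n N x) = x"
  using assms by (auto simp: swap_outer_def Ivals_def)

lemma block_perm_swap_outer:
  assumes "\<beta> \<in> Ivals" "m \<le> M" "n \<le> N"
  shows "block_perm \<beta> (swap_outer \<beta> m M n N)"
proof -
  let ?\<sigma> = "swap_outer \<beta> m M n N"
  have "bij ?\<sigma>"
    using swap_outer_involution[OF assms] by (intro involuntory_imp_bij)
  moreover have "{x. ?\<sigma> x \<noteq> x} \<subseteq> {fst \<beta> - 2 * abs M .. snd \<beta> + 2 * abs N}"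
    using assms by (auto simp: swap_outer_def Ivals_def split: if_splits)
  then have "finite {x. ?\<sigma> x \<noteq> x}" by (rule finite_subset) simp
  moreover have "?\<sigma> x \<le> fst \<beta> \<longleftrightarrow> x \<le> fst \<beta>" "snd \<beta> < ?\<sigma> x \<longleftrightarrow> snd \<beta> < x"
    "fst \<beta> < x \<and> x \<le> snd \<beta> \<longrightarrow> ?\<sigma> x = x" for x
    using assms by (auto simp: swap_outer_def Ivals_def)
  ultimately show ?thesis by (simp add: block_perm_def)
qed

text \<open>It suffices to swap with translates by an amount larger than the length of the square.\<close>

lemma ex_separates:
  assumes "\<beta> \<in> Ivals"
  shows "\<exists>d. separates \<beta> (- n) n (- n) n d"
proof -
  define N where "N = 2 * abs n + abs (fst \<beta>) + abs (snd \<beta>)"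
  have "separates \<beta> (- n) n (- n) n (swap_outer \<beta> (fst \<beta> + n) N (n - snd \<beta>) N)"
    unfolding separates_def
  proof (intro conjI block_perm_swap_outer assms allI impI)
    show "fst \<beta> + n \<le> N" "n - snd \<beta> \<le> N" by (simp_all add: N_def)
  next
    fix x assume "- n < x \<and> x \<le> n \<and> \<not> (fst \<beta> < x \<and> x \<le> snd \<beta>)"
    then show "\<not> (- n < swap_outer \<beta> (fst \<beta> + n) N (n - snd \<beta>) N x \<and>
         swap_outer \<beta> (fst \<beta> + n) N (n - snd \<beta>) N x \<le> n)"
      using assms by (auto simp: swap_outer_def Ivals_def N_def)
  qed
  then show ?thesis by blast
qed

lemma separates_mono:
  assumes "separates \<beta> s t s' t' \<sigma>" "s \<le> s2" "t2 \<le> t" "s' \<le> s3" "t3 \<le> t'"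
  shows "separates \<beta> s2 t2 s3 t3 \<sigma>"
  using assms unfolding separates_def by (meson le_less_trans order_trans)

lemma separates_inv:
  assumes "separates \<beta> s t s' t' \<sigma>"
  shows "separates \<beta> s' t' s t (inv \<sigma>)"
proof -
  have \<sigma>: "block_perm \<beta> \<sigma>" using assms by (simp add: separates_def)
  have "\<not> (s' < inv \<sigma> x \<and> inv \<sigma> x \<le> t')"
    if "s < x \<and> x \<le> t \<and> \<not> (fst \<beta> < x \<and> x \<le> snd \<beta>)" for x
    using assms that block_permD(2,3)[OF \<sigma>, of "inv \<sigma> x"] \<sigma>
    unfolding separates_def by (metis block_perm_inv_simps(1) linorder_not_less)
  then show ?thesis using \<sigma> by (simp add: separates_def)
qed

text \<open>The conjugate has the entries \<open>q (d i) (d j)\<close>. Let \<open>i > s'\<close> and \<open>j \<le> t'\<close>. If \<open>i\<close> or \<open>j\<close> lies in \<open>(s', t']\<close> outside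
  \<open>\<beta>\<close>, then \<open>d\<close> takes it out of the square of \<open>q\<close> and the entry is that of the identity; otherwise
  \<open>i > fst \<beta>\<close> and \<open>j \<le> snd \<beta>\<close>, and the entry is controlled by \<open>q \<in> Q \<beta>\<close>.\<close>

lemma separates_conjugate_Q:
  assumes sep: "separates \<beta> s t s' t' d" and \<beta>: "\<beta> \<in> Ivals" and s't': "s' \<le> fst \<beta>" "snd \<beta> \<le> t'"
    and q: "q \<in> Q \<beta>" "supported s t q"
  shows "perm_mat (inv d) \<odot> q \<odot> perm_mat d \<in> Q (s', t')"
proof -
  have d: "block_perm \<beta> d" using sep by (simp add: separates_def)
  have I: "(s', t') \<in> Ivals" using \<beta> s't' by (auto simp: Ivals_def)
  have GL: "q \<in> GL" by (rule Q_GL[OF q(1)])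
  have "q (d i) (d j) = zone i j" if ij: "s' < i" "j \<le> t'" for i j
  proof -
    have "q (d i) (d j) = zone (d i) (d j)"
    proof (cases "fst \<beta> < i \<and> j \<le> snd \<beta>")
      case True
      then show ?thesis
        using q(1) block_permD(2)[OF d, of i] block_permD(3)[OF d, of j] by (simp add: Q_iff[OF \<beta>])
    next
      case False
      then have "\<not> (s < d i \<and> d i \<le> t) \<or> \<not> (s < d j \<and> d j \<le> t)"
        using sep ij s't' \<beta> unfolding separates_def Ivals_def
        by (smt (verit) case_prod_unfold mem_Collect_eq)
      then show ?thesis by (intro supportedD[OF q(2)]) auto
    qed
    also have "\<dots> = zone i j"
      using d by (auto simp: zone_def dest: arg_cong[of _ _ "inv d"])
    finally show ?thesis .
  qed
  then show ?thesis
    using GL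
    by (simp add: perm_mat_GL[OF d] perm_mat_GL[OF block_perm_inv[OF d]]
        Q_iff[OF I] perm_mat_conjugate[OF d])
qed


section \<open>Independence of the double coset of the choices\<close>

text \<open>The squares used for \<open>A\<close> and \<open>B\<close> also have to contain the middle groups of the two sides on which the matrix
  is taken modulo \<open>Q\<close>, so that matrices in \<open>Q\<close> of such a square can be absorbed.\<close>

definition separated :: "int \<times> int \<Rightarrow> int \<times> int \<Rightarrow> int \<times> int \<Rightarrow>
    'a::comm_ring_1 zmat \<Rightarrow> (int \<Rightarrow> int) \<Rightarrow> 'a zmat \<Rightarrow> bool" where
  "separated \<alpha> \<beta> \<gamma> A \<sigma> B \<longleftrightarrow> (\<exists>s t s' t'.
     (\<forall>\<epsilon> \<in> {\<alpha>, \<beta>}. s \<le> fst \<epsilon> \<and> snd \<epsilon> \<le> t) \<and> (\<forall>\<epsilon> \<in> {\<beta>, \<gamma>}. s' \<le> fst \<epsilon> \<and> snd \<epsilon> \<le> t') \<and>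
     supported s t A \<and> supported s' t' B \<and> separates \<beta> s t s' t' \<sigma>)"

text \<open>Let \<open>Y\<close> be the part of \<open>(s', t']\<close> outside \<open>\<beta>\<close>. The involution \<open>u\<close> exchanges \<open>\<sigma> y\<close> and \<open>d y\<close> for \<open>y \<in> Y\<close>. It
  fixes \<open>(s, t]\<close> because both images of \<open>Y\<close> avoid this interval. Since \<open>u \<circ> \<sigma>\<close> and \<open>d\<close> agree on \<open>Y\<close>, they differ by
  a permutation that fixes \<open>(s', t']\<close>.\<close>

lemma separating_factorization:
  assumes \<beta>: "\<beta> \<in> Ivals" and st: "s \<le> fst \<beta>" "snd \<beta> \<le> t" and s't': "s' \<le> fst \<beta>" "snd \<beta> \<le> t'"
    and \<sigma>: "separates \<beta> s t s' t' \<sigma>" and d: "separates \<beta> s t s' t' d"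
    and disj: "\<And>x y. s' < x \<Longrightarrow> x \<le> t' \<Longrightarrow> \<not> (fst \<beta> < x \<and> x \<le> snd \<beta>) \<Longrightarrow>
      s' < y \<Longrightarrow> y \<le> t' \<Longrightarrow> \<not> (fst \<beta> < y \<and> y \<le> snd \<beta>) \<Longrightarrow> d x \<noteq> \<sigma> y"
  obtains u v where "block_perm (s, t) u" "block_perm (s', t') v" "d = u \<circ> \<sigma> \<circ> v"
proof -
  have le: "fst \<beta> \<le> snd \<beta>" using \<beta> by (auto simp: Ivals_def)
  have b\<sigma>: "block_perm \<beta> \<sigma>" and bd: "block_perm \<beta> d"
    using \<sigma> d by (auto simp: separates_def)
  note D\<sigma> = block_permD[OF b\<sigma>] and Dd = block_permD[OF bd]
  define Y where "Y = {s'<..t'} - {fst \<beta><..snd \<beta>}"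
  have off: "\<not> (s < \<sigma> x \<and> \<sigma> x \<le> t)" "\<not> (s < d x \<and> d x \<le> t)" if "x \<in> Y" for x
    using \<sigma> d that by (auto simp: separates_def Y_def)
  have dis: "d x \<noteq> \<sigma> y" if "x \<in> Y" "y \<in> Y" for x y
    using disj that by (auto simp: Y_def)
  define u where "u y = (if y \<in> \<sigma> ` Y then d (inv \<sigma> y) else if y \<in> d ` Y then \<sigma> (inv d y) else y)" for y
  have u1: "u (\<sigma> x) = d x" if "x \<in> Y" for x
    using that b\<sigma> by (simp add: u_def)
  have u2: "u (d x) = \<sigma> x" if "x \<in> Y" for x
    using that dis bd by (auto simp: u_def)
  have u3: "u y = y" if "y \<notin> \<sigma> ` Y" "y \<notin> d ` Y" for y
    using that by (simp add: u_def)
  have uu: "u (u y) = y" for y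
    using u1 u2 u3 by (cases "y \<in> \<sigma> ` Y"; cases "y \<in> d ` Y") auto
  have fin: "finite {y. u y \<noteq> y}"
  proof (rule finite_subset)
    show "{y. u y \<noteq> y} \<subseteq> \<sigma> ` Y \<union> d ` Y" using u3 by blast
    show "finite (\<sigma> ` Y \<union> d ` Y)" by (simp add: Y_def)
  qed
  have fix_st: "u y = y" if "s < y" "y \<le> t" for y
    using that off by (intro u3) auto
  have zones: "(u y \<le> fst \<beta> \<longleftrightarrow> y \<le> fst \<beta>) \<and> (snd \<beta> < u y \<longleftrightarrow> snd \<beta> < y)" for y
    using u1 u2 u3[of y] D\<sigma>(2,3) Dd(2,3) by (cases "y \<in> \<sigma> ` Y"; cases "y \<in> d ` Y") auto
  have bu: "block_perm \<beta> u"
    using fin zones fix_st st involuntory_imp_bij[OF uu] by (simp add: block_perm_def)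
  have u: "block_perm (s, t) u"
    by (rule block_perm_restrict[OF bu fix_st st(1) le st(2)])
  define v where "v = inv \<sigma> \<circ> (u \<circ> d)"
  have bv: "block_perm \<beta> v" using bu b\<sigma> bd by (simp add: v_def)
  have "v x = x" if "s' < x" "x \<le> t'" for x
  proof (cases "x \<in> Y")
    case True
    then show ?thesis using u2 b\<sigma> by (simp add: v_def)
  next
    case False
    then have "fst \<beta> < x" "x \<le> snd \<beta>" using that by (auto simp: Y_def)
    then show ?thesis using block_permD(4)[OF bv] by simp
  qed
  then have v: "block_perm (s', t') v"
    by (intro block_perm_restrict[OF bv _ s't'(1) le s't'(2)])
  have "d = u \<circ> \<sigma> \<circ> v"
    using b\<sigma> uu by (auto simp: v_def fun_eq_iff)
  with u v show ?thesis by (rule that)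
qed

text \<open>The index \<open>k\<close> is one that the square should reach, for instance an end of a middle group.\<close>

lemma eventually_square:
  assumes "finitary g"
  shows "eventually (\<lambda>n. - n \<le> k \<and> k \<le> n \<and> supported (- n) n g) at_top"
proof -
  have "eventually (\<lambda>n. - k \<le> n \<and> k \<le> n \<and> supported (- n) n g) at_top"
    by (intro eventually_conj eventually_ge_at_top eventually_supported assms)
  then show ?thesis by (rule eventually_mono) auto
qed

text \<open>For large \<open>n\<close> the condition on \<open>d\<close> no longer involves \<open>\<sigma>\<close>, nor the squares by which \<open>A\<close>, \<open>B\<close> and \<open>\<sigma>\<close> are
  compared. So the same \<open>d\<close> can be used for two different separating permutations, and for other matrices.\<close>

lemma dcoset_separated_eventually:
  assumes I: "\<alpha> \<in> Ivals" "\<beta> \<in> Ivals" "\<gamma> \<in> Ivals" and GL: "A \<in> GL" "B \<in> GL"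
    and sep: "separated \<alpha> \<beta> \<gamma> A \<sigma> B"
  shows "eventually (\<lambda>n. \<forall>d. separates \<beta> (- n) n (- n) n d \<longrightarrow>
    dcoset \<alpha> \<gamma> (A \<odot> perm_mat d \<odot> B) = dcoset \<alpha> \<gamma> (A \<odot> perm_mat \<sigma> \<odot> B)) at_top"
proof -
  obtain s t s' t' where b: "s \<le> fst \<alpha>" "s \<le> fst \<beta>" "snd \<alpha> \<le> t" "snd \<beta> \<le> t"
      "s' \<le> fst \<beta>" "s' \<le> fst \<gamma>" "snd \<beta> \<le> t'" "snd \<gamma> \<le> t'"
    and sup: "supported s t A" "supported s' t' B" and \<sigma>: "separates \<beta> s t s' t' \<sigma>"
    using sep by (auto simp: separated_def)
  have b\<sigma>: "block_perm \<beta> \<sigma>" using \<sigma> by (simp add: separates_def)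
  \<comment> \<open>The bound \<open>m\<close> on the image of the right square under \<open>\<sigma>\<close> makes the images under \<open>d\<close> and \<open>\<sigma>\<close> disjoint; inserting 0
    keeps the maximum defined for an empty interval.\<close>
  define m where "m = Max ((\<lambda>y. abs (\<sigma> y)) ` insert 0 {s'<..t'})"
  have m: "abs (\<sigma> y) \<le> m" if "s' < y" "y \<le> t'" for y
    unfolding m_def using that by (intro Max_ge) auto
  have "dcoset \<alpha> \<gamma> (A \<odot> perm_mat d \<odot> B) = dcoset \<alpha> \<gamma> (A \<odot> perm_mat \<sigma> \<odot> B)"
    if n: "n > abs s + abs t + abs s' + abs t' + m" and d: "separates \<beta> (- n) n (- n) n d" for n d
  proof -
    have "abs (\<sigma> 0) \<le> m" unfolding m_def by (intro Max_ge) auto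
    then have "0 \<le> m" by linarith
    then have d': "separates \<beta> s t s' t' d"
      using n by (intro separates_mono[OF d]) auto
    have "d x \<noteq> \<sigma> y"
      if "s' < x" "x \<le> t'" "\<not> (fst \<beta> < x \<and> x \<le> snd \<beta>)" "s' < y" "y \<le> t'" for x y
    proof -
      have "- n < x" "x \<le> n" using that n \<open>0 \<le> m\<close> by linarith+
      then have "\<not> (- n < d x \<and> d x \<le> n)" using d that by (auto simp: separates_def)
      then show ?thesis using m[OF that(4,5)] n by auto
    qed
    then obtain u v where u: "block_perm (s, t) u" and v: "block_perm (s', t') v" and uv: "d = u \<circ> \<sigma> \<circ> v"
      using separating_factorization[OF I(2) b(2,4,5,7) \<sigma> d'] by metis
    have gl: "perm_mat u \<in> (GL :: 'a zmat set)" "perm_mat v \<in> (GL :: 'a zmat set)" "perm_mat \<sigma> \<in> (GL :: 'a zmat set)"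
      using u v b\<sigma> perm_mat_GL by blast+
    have du: "(perm_mat u :: 'a zmat) \<in> Q \<alpha>" by (intro perm_mat_Q I block_perm_mono[OF u] b)
    have dv: "(perm_mat v :: 'a zmat) \<in> Q \<gamma>" by (intro perm_mat_Q I block_perm_mono[OF v] b)
    have "perm_mat d = perm_mat u \<odot> perm_mat \<sigma> \<odot> (perm_mat v :: 'a zmat)"
      using block_permD(1)[OF u] block_permD(1)[OF b\<sigma>] by (simp add: perm_mat_comp bij_comp uv)
    then have "A \<odot> perm_mat d \<odot> B = (A \<odot> perm_mat u) \<odot> perm_mat \<sigma> \<odot> (perm_mat v \<odot> B)"
      using GL gl by (simp add: GL_assoc)
    also have "\<dots> = perm_mat u \<odot> (A \<odot> perm_mat \<sigma> \<odot> B) \<odot> perm_mat v"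
      using GL gl perm_mat_commute[OF u GL(1) sup(1)] perm_mat_commute[OF v GL(2) sup(2)]
      by (simp add: GL_assoc flip: perm_mat_commute[OF u GL(1) sup(1)])
    finally have eq: "A \<odot> perm_mat d \<odot> B = perm_mat u \<odot> (A \<odot> perm_mat \<sigma> \<odot> B) \<odot> perm_mat v" .
    show ?thesis
      unfolding eq using GL gl du dv I by (simp add: dcoset_left dcoset_right)
  qed
  then show ?thesis
    by (intro eventually_mono[OF eventually_gt_at_top[of "abs s + abs t + abs s' + abs t' + m"]]) blast
qed

text \<open>Both sides are compared with one deep permutation \<open>d\<close>. Between \<open>A\<close> and \<open>B\<close> there stands \<open>q d q'\<close> with \<open>q\<close>, \<open>q'\<close> in
  \<open>Q \<beta>\<close>. The factor \<open>q\<close> passes to the right of \<open>d\<close> and leaves through \<open>q' B\<close> on the right end; then \<open>q'\<close> passes to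
  the left of \<open>d\<close> and leaves through \<open>A\<close> on the left end.\<close>

lemma dcoset_separated_representatives:
  assumes I: "\<alpha> \<in> Ivals" "\<beta> \<in> Ivals" "\<gamma> \<in> Ivals"
    and A: "A \<in> GL" "A' \<in> dcoset \<alpha> \<beta> A" and B: "B \<in> GL" "B' \<in> dcoset \<beta> \<gamma> B"
    and sep: "separated \<alpha> \<beta> \<gamma> A \<sigma> B" and sep': "separated \<alpha> \<beta> \<gamma> A' \<tau> B'"
  shows "dcoset \<alpha> \<gamma> (A' \<odot> perm_mat \<tau> \<odot> B') = dcoset \<alpha> \<gamma> (A \<odot> perm_mat \<sigma> \<odot> B)"
proof -
  obtain p q where pq: "p \<in> Q \<alpha>" "q \<in> Q \<beta>" "A' = p \<odot> A \<odot> q"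
    using A by (auto simp: dcoset_def)
  obtain q' r where qr: "q' \<in> Q \<beta>" "r \<in> Q \<gamma>" "B' = q' \<odot> B \<odot> r"
    using B by (auto simp: dcoset_def)
  have "p \<in> GL" "q \<in> GL" "q' \<in> GL" "r \<in> GL"
    using pq qr by (auto dest: Q_GL)
  moreover from this have "A' \<in> GL" "B' \<in> GL"
    using pq(3) qr(3) A(1) B(1) by simp_all
  ultimately have GL: "p \<in> GL" "q \<in> GL" "q' \<in> GL" "r \<in> GL" "A' \<in> GL" "B' \<in> GL"
    by auto
  note fin = finitary_GL[OF A(1)] finitary_GL[OF B(1)] finitary_GL[OF GL(2)] finitary_GL[OF GL(3)]
  have "eventually (\<lambda>n.
      (\<forall>d. separates \<beta> (- n) n (- n) n d \<longrightarrow>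
        dcoset \<alpha> \<gamma> (A \<odot> perm_mat d \<odot> B) = dcoset \<alpha> \<gamma> (A \<odot> perm_mat \<sigma> \<odot> B)) \<and>
      (\<forall>d. separates \<beta> (- n) n (- n) n d \<longrightarrow>
        dcoset \<alpha> \<gamma> (A' \<odot> perm_mat d \<odot> B') = dcoset \<alpha> \<gamma> (A' \<odot> perm_mat \<tau> \<odot> B')) \<and>
      (- n \<le> fst \<alpha> \<and> fst \<alpha> \<le> n \<and> supported (- n) n A) \<and>
      (- n \<le> snd \<alpha> \<and> snd \<alpha> \<le> n \<and> supported (- n) n B) \<and>
      (- n \<le> fst \<beta> \<and> fst \<beta> \<le> n \<and> supported (- n) n q) \<and>
      (- n \<le> snd \<beta> \<and> snd \<beta> \<le> n \<and> supported (- n) n q') \<and>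
      (- n \<le> fst \<gamma> \<and> fst \<gamma> \<le> n \<and> supported (- n) n q) \<and>
      (- n \<le> snd \<gamma> \<and> snd \<gamma> \<le> n \<and> supported (- n) n q')) at_top"
    using I A(1) B(1) GL(5,6) sep sep' fin
    by (intro eventually_conj dcoset_separated_eventually eventually_square)
  from eventually_happens[OF this] obtain n where
      n: "\<And>d. separates \<beta> (- n) n (- n) n d \<Longrightarrow>
        dcoset \<alpha> \<gamma> (A \<odot> perm_mat d \<odot> B) = dcoset \<alpha> \<gamma> (A \<odot> perm_mat \<sigma> \<odot> B)"
      "\<And>d. separates \<beta> (- n) n (- n) n d \<Longrightarrow>
        dcoset \<alpha> \<gamma> (A' \<odot> perm_mat d \<odot> B') = dcoset \<alpha> \<gamma> (A' \<odot> perm_mat \<tau> \<odot> B')"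
    and sup: "supported (- n) n A" "supported (- n) n B" "supported (- n) n q" "supported (- n) n q'"
    and b: "- n \<le> fst \<alpha>" "snd \<alpha> \<le> n" "- n \<le> fst \<beta>" "snd \<beta> \<le> n" "- n \<le> fst \<gamma>" "snd \<gamma> \<le> n"
    by auto
  have n0: "- n \<le> n" using b I by (auto simp: Ivals_def)
  obtain d where d: "separates \<beta> (- n) n (- n) n d"
    using ex_separates[OF I(2)] by blast
  have bd: "block_perm \<beta> d" using d by (simp add: separates_def)
  have Dgl: "perm_mat d \<in> (GL :: 'a zmat set)" "perm_mat (inv d) \<in> (GL :: 'a zmat set)"
    using perm_mat_GL[OF bd] perm_mat_GL[OF block_perm_inv[OF bd]] by auto
  let ?D = "perm_mat d :: 'a zmat" and ?D' = "perm_mat (inv d) :: 'a zmat"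
  define x where "x = ?D' \<odot> q \<odot> ?D"
  have x: "x \<in> Q (- n, n)"
    unfolding x_def by (rule separates_conjugate_Q[OF d I(2) b(3,4) pq(2) sup(3)])
  define y where "y = ginv (q' \<odot> B) \<odot> x \<odot> (q' \<odot> B)"
  have y: "y \<in> Q \<gamma>"
    unfolding y_def using GL B sup n0 x b I
    by (intro Q_mono[OF conjugate_Q_supported]) (auto intro: supported_zmult)
  define z where "z = ?D \<odot> q' \<odot> ?D'"
  have z: "z \<in> Q (- n, n)"
    unfolding z_def using separates_conjugate_Q[OF separates_inv[OF d] I(2) b(3,4) qr(1) sup(4)] bd by simp
  define w where "w = ginv (ginv A) \<odot> z \<odot> ginv A"
  have w: "w \<in> Q \<alpha>"
    unfolding w_def using A sup n0 z b I
    by (intro Q_mono[OF conjugate_Q_supported]) (auto intro: supported_ginv)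
  have gl: "x \<in> GL" "y \<in> GL" "z \<in> GL" "w \<in> GL"
    using x y z w by (auto dest: Q_GL)
  have qD: "q \<odot> ?D = ?D \<odot> x"
    using GL Dgl by (simp add: x_def GL_assoc perm_mat_cancel[OF bd])
  have xB: "x \<odot> (q' \<odot> B) = (q' \<odot> B) \<odot> y"
    unfolding y_def using GL B gl by (simp only: zmult_conjugate GL_zmult)
  have Dq: "?D \<odot> q' = z \<odot> ?D"
    using GL Dgl by (simp add: z_def GL_assoc perm_mat_inv[OF bd] zmult_zone_GL)
  have Az: "A \<odot> z = w \<odot> A"
    using A gl by (simp add: w_def ginv_ginv GL_assoc zmult_zone_GL)
  have "A' \<odot> ?D \<odot> B' = p \<odot> A \<odot> (q \<odot> ?D) \<odot> (q' \<odot> B) \<odot> r"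
    using pq qr A B GL Dgl by (simp add: GL_assoc)
  also have "\<dots> = p \<odot> A \<odot> ?D \<odot> (x \<odot> (q' \<odot> B)) \<odot> r"
    using A B GL Dgl gl unfolding qD by (simp add: GL_assoc)
  also have "\<dots> = p \<odot> A \<odot> (?D \<odot> q') \<odot> B \<odot> y \<odot> r"
    using A B GL Dgl gl unfolding xB by (simp add: GL_assoc)
  also have "\<dots> = p \<odot> (A \<odot> z) \<odot> ?D \<odot> B \<odot> y \<odot> r"
    using A B GL Dgl gl unfolding Dq by (simp add: GL_assoc)
  also have "\<dots> = p \<odot> (w \<odot> (A \<odot> ?D \<odot> B \<odot> y \<odot> r))"
    using A B GL Dgl gl unfolding Az by (simp add: GL_assoc)
  finally have eq: "A' \<odot> ?D \<odot> B' = p \<odot> (w \<odot> (A \<odot> ?D \<odot> B \<odot> y \<odot> r))" .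
  have "dcoset \<alpha> \<gamma> (A' \<odot> ?D \<odot> B') = dcoset \<alpha> \<gamma> (A \<odot> ?D \<odot> B)"
    unfolding eq using A B GL Dgl gl pq qr w y I by (simp add: dcoset_left dcoset_right)
  then show ?thesis using n d by simp
qed

section \<open>The product of matrices in permutation form\<close>

lemma hcat_empty: "hcat X (0\<^sub>m 0 0) = X"
  by (rule eq_matI) (auto simp: hcat_def)

lemma vcat_empty: "vcat X (0\<^sub>m 0 0) = X"
  by (rule eq_matI) (auto simp: vcat_def)

lemma hcat_sub_block:
  assumes "q \<le> q'" "q' \<le> q''"
  shows "hcat (sub_block g p p' q q') (sub_block g p p' q' q'') = sub_block g p p' q q''"
  using assms by (intro eq_matI) (auto simp: hcat_def sub_block_def algebra_simps nat_diff_distrib of_nat_diff)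

lemma vcat_sub_block:
  assumes "p \<le> p'" "p' \<le> p''"
  shows "vcat (sub_block g p p' q q') (sub_block g p' p'' q q') = sub_block g p p'' q q'"
  using assms by (intro eq_matI) (auto simp: vcat_def sub_block_def algebra_simps of_nat_diff)

text \<open>With this, a matrix given by blocks is recognised as a square of an infinite matrix by comparing
  blocks one at a time.\<close>

lemma block_mat_sub_block:
  assumes "p0 \<le> p1" "p1 \<le> p2" "p2 \<le> p3" "p3 \<le> p4" "p4 \<le> p5"
    and "q0 \<le> q1" "q1 \<le> q2" "q2 \<le> q3" "q3 \<le> q4" "q4 \<le> q5"
  shows "block_mat
     [[sub_block g p0 p1 q0 q1, sub_block g p0 p1 q1 q2, sub_block g p0 p1 q2 q3, sub_block g p0 p1 q3 q4, sub_block g p0 p1 q4 q5],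
      [sub_block g p1 p2 q0 q1, sub_block g p1 p2 q1 q2, sub_block g p1 p2 q2 q3, sub_block g p1 p2 q3 q4, sub_block g p1 p2 q4 q5],
      [sub_block g p2 p3 q0 q1, sub_block g p2 p3 q1 q2, sub_block g p2 p3 q2 q3, sub_block g p2 p3 q3 q4, sub_block g p2 p3 q4 q5],
      [sub_block g p3 p4 q0 q1, sub_block g p3 p4 q1 q2, sub_block g p3 p4 q2 q3, sub_block g p3 p4 q3 q4, sub_block g p3 p4 q4 q5],
      [sub_block g p4 p5 q0 q1, sub_block g p4 p5 q1 q2, sub_block g p4 p5 q2 q3, sub_block g p4 p5 q3 q4, sub_block g p4 p5 q4 q5]]
    = sub_block g p0 p5 q0 q5"
  using assms by (simp add: block_mat_def hcat_empty vcat_empty hcat_sub_block vcat_sub_block)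

lemma zero_eq_sub_block:
  assumes "m = nat (p' - p)" "n = nat (q' - q)"
    and "\<And>i j. p < i \<Longrightarrow> i \<le> p' \<Longrightarrow> q < j \<Longrightarrow> j \<le> q' \<Longrightarrow> g i j = 0"
  shows "0\<^sub>m m n = sub_block g p p' q q'"
  using assms by (intro eq_matI) (auto simp: sub_block_def)

lemma one_eq_sub_block:
  assumes "m = nat (p' - p)" "q' - q = p' - p"
    and "\<And>i j. p < i \<Longrightarrow> i \<le> p' \<Longrightarrow> q < j \<Longrightarrow> j \<le> q' \<Longrightarrow> g i j = zone (i - p) (j - q)"
  shows "1\<^sub>m m = sub_block g p p' q q'"
  using assms by (intro eq_matI) (auto simp: sub_block_def zone_def)

lemma sub_block_shift:
  assumes "r' - r = p' - p" "c' - c = q' - q"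
    and "\<And>i j. p < i \<Longrightarrow> i \<le> p' \<Longrightarrow> q < j \<Longrightarrow> j \<le> q' \<Longrightarrow> g i j = h (i + (r - p)) (j + (c - q))"
  shows "sub_block h r r' c c' = sub_block g p p' q q'"
  using assms by (intro eq_matI) (auto simp: sub_block_def algebra_simps)

lemma place_mult:
  assumes "supported u v g" "supported u v h"
  shows "place u v (sub_block g u v u v * sub_block h u v u v) = g \<odot> h"
proof (intro ext)
  fix i j
  show "place u v (sub_block g u v u v * sub_block h u v u v) i j = (g \<odot> h) i j"
  proof (cases "u < i \<and> i \<le> v \<and> u < j \<and> j \<le> v")
    case True
    have "place u v (sub_block g u v u v * sub_block h u v u v) i j =
        (\<Sum>c<nat (v - u). g i (u + 1 + int c) * h (u + 1 + int c) j)"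
      using True by (simp add: place_def sub_block_def scalar_prod_def atLeast0LessThan)
    also have "\<dots> = (\<Sum>k\<in>{u<..v}. g i k * h k j)"
      by (rule sum.reindex_bij_witness[of _ "\<lambda>k. nat (k - u - 1)" "\<lambda>c. u + 1 + int c"]) auto
    also have "\<dots> = (g \<odot> h) i j"
      using True by (simp add: zmult_supported[OF assms(1)])
    finally show ?thesis .
  next
    case False
    then show ?thesis
      using supportedD[OF supported_zmult[OF assms], of i j] by (auto simp: place_def)
  qed
qed

text \<open>The two identity blocks of \<open>circ\<close> are the matrix \<open>A\<close> itself outside its square.\<close>

lemma circ_eq_sub_block:
  assumes "\<alpha> \<in> Ivals" "\<beta> \<in> Ivals" "s \<le> fst \<alpha>" "snd \<alpha> \<le> t" "s \<le> fst \<beta>" "snd \<beta> \<le> t"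
    and A: "supported s t A"
  shows "circ \<alpha> \<beta> s t A =
    sub_block A (s - (fst \<beta> - s)) (t + (t - snd \<beta>)) (s - (fst \<beta> - s)) (t + (t - snd \<beta>))"
proof -
  have le: "fst \<alpha> \<le> snd \<alpha>" "fst \<beta> \<le> snd \<beta>"
    using assms(1,2) by (auto simp: Ivals_def)
  have cuts: "s - (fst \<beta> - s) \<le> s" "s \<le> fst \<alpha>" "fst \<alpha> \<le> snd \<alpha>" "snd \<alpha> \<le> t" "t \<le> t + (t - snd \<beta>)"
    "s - (fst \<beta> - s) \<le> s" "s \<le> fst \<beta>" "fst \<beta> \<le> snd \<beta>" "snd \<beta> \<le> t" "t \<le> t + (t - snd \<beta>)"
    using le assms(3-6) by auto
  show ?thesis
    unfolding block_mat_sub_block[OF cuts, symmetric] circ_def Let_def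
    apply (rule arg_cong[where f = block_mat])
    apply (simp only: list.inject simp_thms)
    apply (intro conjI zero_eq_sub_block one_eq_sub_block)
    using cuts supportedD[OF A] by (simp_all add: zone_def)
qed

text \<open>The order in which \<open>lozenge\<close> lists its columns. Left of the middle group, the columns of \<open>B\<close> with \<open>s < j \<le> fst \<gamma>\<close>
  come before the \<open>m\<close> added columns; right of it, the \<open>n\<close> added columns come before those of \<open>B\<close> with
  \<open>snd \<gamma> < j \<le> t\<close>. The natural order would be the opposite one on both sides.\<close>

definition merge_perm :: "int \<times> int \<Rightarrow> int \<Rightarrow> int \<Rightarrow> int \<Rightarrow> int \<Rightarrow> int \<Rightarrow> int" where
  "merge_perm \<gamma> s t m n j =
     (if s - m < j \<and> j \<le> fst \<gamma> - m then j + m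
      else if fst \<gamma> - m < j \<and> j \<le> fst \<gamma> then j - (fst \<gamma> - s)
      else if snd \<gamma> < j \<and> j \<le> snd \<gamma> + n then j + (t - snd \<gamma>)
      else if snd \<gamma> + n < j \<and> j \<le> t + n then j - n
      else j)"

lemma block_perm_merge_perm:
  assumes "\<gamma> \<in> Ivals" "s \<le> fst \<gamma>" "snd \<gamma> \<le> t" "0 \<le> m" "0 \<le> n"
  shows "block_perm \<gamma> (merge_perm \<gamma> s t m n)"
proof -
  obtain g h where \<gamma>: "\<gamma> = (g, h)" and gh: "g \<le> h" "s \<le> g" "h \<le> t"
    using assms by (auto simp: Ivals_def)
  define \<kappa> where "\<kappa> x =
     (if s - m < x \<and> x \<le> g - m then x + m
      else if g - m < x \<and> x \<le> g then x - (g - s)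
      else if h < x \<and> x \<le> h + n then x + (t - h)
      else if h + n < x \<and> x \<le> t + n then x - n
      else x)" for x
  \<comment> \<open>the inverse permutation\<close>
  define \<iota> where "\<iota> x =
     (if s < x \<and> x \<le> g then x - m
      else if s - m < x \<and> x \<le> s then x + (g - s)
      else if h < x \<and> x \<le> t then x + n
      else if t < x \<and> x \<le> t + n then x - (t - h)
      else x)" for x
  have eq: "merge_perm \<gamma> s t m n = \<kappa>"
    by (simp add: fun_eq_iff merge_perm_def \<kappa>_def \<gamma>)
  note nonneg = gh assms(4,5)
  have 1: "\<iota> (\<kappa> x) = x" for x
  proof -
    consider "s - m < x" "x \<le> g - m" | "g - m < x" "x \<le> g" | "h < x" "x \<le> h + n"
      | "h + n < x" "x \<le> t + n" | "x \<le> s - m \<or> g < x \<and> x \<le> h \<or> t + n < x"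
      using nonneg by linarith
    then show ?thesis using nonneg by cases (auto simp: \<kappa>_def \<iota>_def)
  qed
  have 2: "\<kappa> (\<iota> x) = x" for x
  proof -
    consider "s < x" "x \<le> g" | "s - m < x" "x \<le> s" | "h < x" "x \<le> t"
      | "t < x" "x \<le> t + n" | "x \<le> s - m \<or> g < x \<and> x \<le> h \<or> t + n < x"
      using nonneg by linarith
    then show ?thesis using nonneg by cases (auto simp: \<kappa>_def \<iota>_def)
  qed
  from 1 2 have "bij \<kappa>"
    by (intro o_bij[of \<iota>]) auto
  moreover have "s - m \<le> x \<and> x \<le> t + n" if "\<kappa> x \<noteq> x" for x
    using that gh assms(4,5) unfolding \<kappa>_def by smt
  then have "{x. \<kappa> x \<noteq> x} \<subseteq> {s - m .. t + n}" by auto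
  then have "finite {x. \<kappa> x \<noteq> x}" by (rule finite_subset) simp
  moreover have "\<kappa> x \<le> g \<longleftrightarrow> x \<le> g" "h < \<kappa> x \<longleftrightarrow> h < x" "g < x \<and> x \<le> h \<longrightarrow> \<kappa> x = x" for x
    using gh assms(4,5) unfolding \<kappa>_def by smt+
  ultimately show ?thesis by (simp add: block_perm_def eq) (simp add: \<gamma>)
qed

lemma supported_perm_mat:
  assumes "block_perm \<beta> \<sigma>" "\<And>x. \<not> (u < x \<and> x \<le> v) \<Longrightarrow> \<sigma> x = x"
  shows "supported u v (perm_mat \<sigma>)"
proof -
  have "i = \<sigma> j \<longleftrightarrow> i = j" if "\<not> (u < i \<and> i \<le> v \<and> u < j \<and> j \<le> v)" for i j
    using that assms(2)[of i] assms(2)[of j] block_permD(1)[OF assms(1)] by (metis bij_pointE)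
  then show ?thesis by (simp add: supported_def perm_mat_def zone_def)
qed

text \<open>The row of \<open>B\<close> listed at position \<open>i\<close> in \<open>lozenge\<close> has the number \<open>\<rho> i\<close>, where \<open>\<rho>\<close> exchanges the rows \<open>s < i \<le> fst \<beta>\<close>
  with the \<open>m\<close> added rows before them and the rows \<open>snd \<beta> < i \<le> t\<close> with the \<open>n\<close> added rows after them.\<close>

lemma star_eq:
  fixes A B :: "'a::comm_ring_1 zmat"
  assumes I: "\<alpha> \<in> Ivals" "\<beta> \<in> Ivals" "\<gamma> \<in> Ivals" and adm: "admissible \<alpha> \<beta> \<gamma> s t A B"
  defines "m \<equiv> fst \<beta> - s" and "n \<equiv> t - snd \<beta>"
  assumes GL: "A \<in> GL" "B \<in> GL"
  shows "star \<alpha> \<beta> \<gamma> s t A B = A \<odot> perm_mat (swap_outer \<beta> m m n n) \<odot> B \<odot> perm_mat (merge_perm \<gamma> s t m n)"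
proof -
  let ?\<rho> = "swap_outer \<beta> m m n n" and ?\<kappa> = "merge_perm \<gamma> s t m n"
  define u where "u = s - m"
  define v where "v = t + n"
  have le: "fst \<alpha> \<le> snd \<alpha>" "fst \<beta> \<le> snd \<beta>" "fst \<gamma> \<le> snd \<gamma>" "s \<le> fst \<alpha>" "s \<le> fst \<beta>" "s \<le> fst \<gamma>"
    "snd \<alpha> \<le> t" "snd \<beta> \<le> t" "snd \<gamma> \<le> t"
    and sup: "supported s t A" "supported s t B"
    using I adm by (auto simp: Ivals_def admissible_def)
  have \<rho>: "block_perm \<beta> ?\<rho>" by (rule block_perm_swap_outer[OF I(2)]) auto
  have \<kappa>: "block_perm \<gamma> ?\<kappa>" using le I by (intro block_perm_merge_perm) (auto simp: m_def n_def)
  define L where "L = perm_mat ?\<rho> \<odot> B \<odot> perm_mat ?\<kappa>"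
  have gl: "perm_mat ?\<rho> \<in> (GL :: 'a zmat set)" "perm_mat ?\<kappa> \<in> (GL :: 'a zmat set)"
    using \<rho> \<kappa> perm_mat_GL by blast+
  have inv: "inv ?\<rho> = ?\<rho>"
    using swap_outer_involution[OF I(2)] by (intro inv_equality) auto
  have L: "L i j = B (?\<rho> i) (?\<kappa> j)" for i j
    using gl GL block_permD(1)[OF \<rho>]
    by (simp add: L_def zmult_perm_mat finitary_GL perm_mat_zmult inv)
  have sL: "supported u v L"
    unfolding L_def
  proof (intro supported_zmult)
    show "supported u v (perm_mat ?\<rho>)"
      by (rule supported_perm_mat[OF \<rho>]) (use le in \<open>auto simp: swap_outer_def u_def v_def m_def n_def\<close>)
    show "supported u v (perm_mat ?\<kappa>)"
      by (rule supported_perm_mat[OF \<kappa>]) (use le in \<open>auto simp: merge_perm_def u_def v_def m_def n_def\<close>)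
    show "supported u v B"
      using le by (intro supported_mono[OF sup(2)]) (auto simp: u_def v_def m_def n_def)
  qed
  have sA: "supported u v A"
    using le by (intro supported_mono[OF sup(1)]) (auto simp: u_def v_def m_def n_def)
  have cuts: "u \<le> s" "s \<le> fst \<beta>" "fst \<beta> \<le> snd \<beta>" "snd \<beta> \<le> t" "t \<le> v"
    "u \<le> fst \<gamma> - m" "fst \<gamma> - m \<le> fst \<gamma>" "fst \<gamma> \<le> snd \<gamma>" "snd \<gamma> \<le> snd \<gamma> + n" "snd \<gamma> + n \<le> v"
    using le by (auto simp: u_def v_def m_def n_def)
  have "lozenge \<beta> \<gamma> s t B = sub_block L u v u v"
    unfolding block_mat_sub_block[OF cuts, symmetric] lozenge_def Let_def
    apply (rule arg_cong[where f = block_mat])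
    apply (simp only: list.inject simp_thms)
    apply (intro conjI zero_eq_sub_block one_eq_sub_block sub_block_shift)
    using le supportedD[OF sup(2)]
    apply (simp_all add: L swap_outer_def merge_perm_def u_def v_def m_def n_def zone_def)
    by (simp_all add: algebra_simps)
  moreover have "circ \<alpha> \<beta> s t A = sub_block A u v u v"
    using circ_eq_sub_block[OF I(1,2) le(4,7,5,8) sup(1)] by (simp add: u_def v_def m_def n_def)
  ultimately have "star \<alpha> \<beta> \<gamma> s t A B = A \<odot> L"
    using place_mult[OF sA sL] by (simp add: star_def u_def v_def m_def n_def)
  then show ?thesis using GL gl by (simp add: L_def GL_assoc)
qed

section \<open>The product of double cosets\<close>

lemma separates_star:
  assumes "\<beta> \<in> Ivals"
  shows "separates \<beta> s t s t (swap_outer \<beta> (fst \<beta> - s) (fst \<beta> - s) (t - snd \<beta>) (t - snd \<beta>))"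
  using block_perm_swap_outer[OF assms] assms
  by (auto simp: separates_def swap_outer_def Ivals_def)

lemma ex_admissible:
  assumes "A \<in> GL" "B \<in> GL"
  shows "\<exists>n. admissible \<alpha> \<beta> \<gamma> (- n) n A B"
proof -
  note fin = finitary_GL[OF assms(1)] finitary_GL[OF assms(2)]
  have "eventually (\<lambda>n.
      (- n \<le> fst \<alpha> \<and> fst \<alpha> \<le> n \<and> supported (- n) n A) \<and>
      (- n \<le> snd \<alpha> \<and> snd \<alpha> \<le> n \<and> supported (- n) n B) \<and>
      (- n \<le> fst \<beta> \<and> fst \<beta> \<le> n \<and> supported (- n) n B) \<and>
      (- n \<le> snd \<beta> \<and> snd \<beta> \<le> n \<and> supported (- n) n B) \<and>
      (- n \<le> fst \<gamma> \<and> fst \<gamma> \<le> n \<and> supported (- n) n B) \<and>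
      (- n \<le> snd \<gamma> \<and> snd \<gamma> \<le> n \<and> supported (- n) n B)) at_top"
    using fin by (intro eventually_conj eventually_square)
  from eventually_happens[OF this] show ?thesis
    by (auto simp: admissible_def)
qed

lemma admissible_separated:
  assumes "\<beta> \<in> Ivals" "admissible \<alpha> \<beta> \<gamma> s t A B"
  shows "separated \<alpha> \<beta> \<gamma> A (swap_outer \<beta> (fst \<beta> - s) (fst \<beta> - s) (t - snd \<beta>) (t - snd \<beta>)) B"
  unfolding separated_def
  by (rule exI[of _ s], rule exI[of _ t], rule exI[of _ s], rule exI[of _ t])
    (use assms separates_star[OF assms(1)] in \<open>auto simp: admissible_def\<close>)

lemma separated_block_perm: "separated \<alpha> \<beta> \<gamma> A \<sigma> B \<Longrightarrow> block_perm \<beta> \<sigma>"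
  by (auto simp: separated_def separates_def)

lemma is_product_separated:
  fixes A B :: "'a::comm_ring_1 zmat"
  assumes I: "\<alpha> \<in> Ivals" "\<beta> \<in> Ivals" "\<gamma> \<in> Ivals" and GL: "A \<in> GL" "B \<in> GL"
    and sep: "separated \<alpha> \<beta> \<gamma> A \<sigma> B"
  shows "is_product \<alpha> \<beta> \<gamma> (dcoset \<alpha> \<beta> A) (dcoset \<beta> \<gamma> B) (dcoset \<alpha> \<gamma> (A \<odot> perm_mat \<sigma> \<odot> B))"
  unfolding is_product_def
proof (intro conjI ballI allI impI)
  show "dcoset \<alpha> \<gamma> (A \<odot> perm_mat \<sigma> \<odot> B) \<in> dcosets \<alpha> \<gamma>"
    unfolding dcosets_def
    using GL perm_mat_GL[OF separated_block_perm[OF sep]] by (intro imageI GL_zmult)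
next
  fix A' B' s t
  assume A': "A' \<in> dcoset \<alpha> \<beta> A" and B': "B' \<in> dcoset \<beta> \<gamma> B" and adm: "admissible \<alpha> \<beta> \<gamma> s t A' B'"
  define \<rho> where "\<rho> = swap_outer \<beta> (fst \<beta> - s) (fst \<beta> - s) (t - snd \<beta>) (t - snd \<beta>)"
  define \<kappa> where "\<kappa> = merge_perm \<gamma> s t (fst \<beta> - s) (t - snd \<beta>)"
  have GL': "A' \<in> GL" "B' \<in> GL"
    using dcoset_eq(1) I GL A' B' by blast+
  have sep': "separated \<alpha> \<beta> \<gamma> A' \<rho> B'"
    unfolding \<rho>_def by (rule admissible_separated[OF I(2) adm])
  have R: "perm_mat \<rho> \<in> (GL :: 'a zmat set)"
    by (rule perm_mat_GL[OF separated_block_perm[OF sep']])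
  have "block_perm \<gamma> \<kappa>"
    unfolding \<kappa>_def using adm I by (intro block_perm_merge_perm) (auto simp: admissible_def)
  then have K: "(perm_mat \<kappa> :: 'a zmat) \<in> Q \<gamma>"
    by (rule perm_mat_Q[OF I(3)])
  have star: "star \<alpha> \<beta> \<gamma> s t A' B' = A' \<odot> perm_mat \<rho> \<odot> B' \<odot> perm_mat \<kappa>"
    unfolding \<rho>_def \<kappa>_def by (rule star_eq[OF I adm GL'])
  have "star \<alpha> \<beta> \<gamma> s t A' B' \<in> dcoset \<alpha> \<gamma> (star \<alpha> \<beta> \<gamma> s t A' B')"
    unfolding star using GL' R Q_GL[OF K] I by (intro dcoset_self GL_zmult)
  also have "dcoset \<alpha> \<gamma> (star \<alpha> \<beta> \<gamma> s t A' B') = dcoset \<alpha> \<gamma> (A' \<odot> perm_mat \<rho> \<odot> B')"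
    unfolding star using GL' R K I by (intro dcoset_right GL_zmult)
  also have "\<dots> = dcoset \<alpha> \<gamma> (A \<odot> perm_mat \<sigma> \<odot> B)"
    by (rule dcoset_separated_representatives[OF I GL(1) A' GL(2) B' sep sep'])
  finally show "star \<alpha> \<beta> \<gamma> s t A' B' \<in> dcoset \<alpha> \<gamma> (A \<odot> perm_mat \<sigma> \<odot> B)" .
qed

lemma dcosetsE:
  assumes "a \<in> dcosets \<alpha> \<beta>"
  obtains A where "A \<in> GL" "a = dcoset \<alpha> \<beta> A"
  using assms by (auto simp: dcosets_def)

text \<open>Some square is admissible for any two representatives, so both double cosets contain the same matrix.\<close>

lemma is_product_unique:
  assumes I: "\<alpha> \<in> Ivals" "\<beta> \<in> Ivals" "\<gamma> \<in> Ivals" and ab: "a \<in> dcosets \<alpha> \<beta>" "b \<in> dcosets \<beta> \<gamma>"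
    and c: "is_product \<alpha> \<beta> \<gamma> a b c" "is_product \<alpha> \<beta> \<gamma> a b c'"
  shows "c = c'"
proof -
  obtain A where A: "A \<in> GL" "a = dcoset \<alpha> \<beta> A" using ab(1) by (rule dcosetsE)
  obtain B where B: "B \<in> GL" "b = dcoset \<beta> \<gamma> B" using ab(2) by (rule dcosetsE)
  obtain n where "admissible \<alpha> \<beta> \<gamma> (- n) n A B" using ex_admissible[OF A(1) B(1)] by blast
  moreover have "A \<in> a" "B \<in> b" using A B I by (auto intro: dcoset_self)
  ultimately have *: "star \<alpha> \<beta> \<gamma> (- n) n A B \<in> c \<inter> c'" and cc: "c \<in> dcosets \<alpha> \<gamma>" "c' \<in> dcosets \<alpha> \<gamma>"
    using c by (auto simp: is_product_def)
  obtain g where g: "g \<in> GL" "c = dcoset \<alpha> \<gamma> g" using cc(1) by (rule dcosetsE)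
  obtain h where h: "h \<in> GL" "c' = dcoset \<alpha> \<gamma> h" using cc(2) by (rule dcosetsE)
  show ?thesis
    using * dcoset_eq(2)[OF I(1,3) g(1)] dcoset_eq(2)[OF I(1,3) h(1)] unfolding g(2) h(2) by blast
qed

lemma ex1_is_product:
  assumes I: "\<alpha> \<in> Ivals" "\<beta> \<in> Ivals" "\<gamma> \<in> Ivals" and ab: "a \<in> dcosets \<alpha> \<beta>" "b \<in> dcosets \<beta> \<gamma>"
  shows "\<exists>!c. is_product \<alpha> \<beta> \<gamma> a b c"
proof -
  obtain A where A: "A \<in> GL" "a = dcoset \<alpha> \<beta> A" using ab(1) by (rule dcosetsE)
  obtain B where B: "B \<in> GL" "b = dcoset \<beta> \<gamma> B" using ab(2) by (rule dcosetsE)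
  obtain n where "admissible \<alpha> \<beta> \<gamma> (- n) n A B" using ex_admissible[OF A(1) B(1)] by blast
  from is_product_separated[OF I A(1) B(1) admissible_separated[OF I(2) this]]
  show ?thesis
    using is_product_unique[OF I ab] unfolding A(2) B(2) by blast
qed

lemma coset_star_separated:
  assumes I: "\<alpha> \<in> Ivals" "\<beta> \<in> Ivals" "\<gamma> \<in> Ivals" and GL: "A \<in> GL" "B \<in> GL"
    and sep: "separated \<alpha> \<beta> \<gamma> A \<sigma> B"
  shows "coset_star \<alpha> \<beta> \<gamma> (dcoset \<alpha> \<beta> A) (dcoset \<beta> \<gamma> B) = dcoset \<alpha> \<gamma> (A \<odot> perm_mat \<sigma> \<odot> B)"
proof -
  have "dcoset \<alpha> \<beta> A \<in> dcosets \<alpha> \<beta>" "dcoset \<beta> \<gamma> B \<in> dcosets \<beta> \<gamma>"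
    using GL by (auto simp: dcosets_def)
  then show ?thesis
    unfolding coset_star_def
    by (rule the1_equality[OF ex1_is_product[OF I] is_product_separated[OF I GL sep]])
qed


section \<open>Associativity\<close>

lemma separatedI:
  assumes "\<And>\<epsilon>. \<epsilon> \<in> {\<alpha>, \<beta>} \<Longrightarrow> s \<le> fst \<epsilon> \<and> snd \<epsilon> \<le> t"
    and "\<And>\<epsilon>. \<epsilon> \<in> {\<beta>, \<gamma>} \<Longrightarrow> s' \<le> fst \<epsilon> \<and> snd \<epsilon> \<le> t'"
    and "supported s t A" "supported s' t' B" "separates \<beta> s t s' t' \<sigma>"
  shows "separated \<alpha> \<beta> \<gamma> A \<sigma> B"
  using assms unfolding separated_def by blast

lemma disjoint_support_commute:
  assumes "inj \<kappa>" "inj \<tau>" "\<And>x. \<kappa> x = x \<or> \<tau> x = x"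
  shows "\<kappa> \<circ> \<tau> = \<tau> \<circ> \<kappa>"
proof
  fix x
  show "(\<kappa> \<circ> \<tau>) x = (\<tau> \<circ> \<kappa>) x"
  proof (cases "\<tau> x = x")
    case True
    have "\<tau> (\<kappa> x) = \<kappa> x"
      using assms(3)[of "\<kappa> x"] injD[OF assms(1), of "\<kappa> x" x] True by metis
    then show ?thesis by (simp add: True)
  next
    case False
    then have "\<kappa> x = x" "\<kappa> (\<tau> x) = \<tau> x"
      using assms(3)[of x] assms(3)[of "\<tau> x"] injD[OF assms(2), of "\<tau> x" x] by metis+
    then show ?thesis by simp
  qed
qed

text \<open>Let \<open>(s, t]\<close> be a square for all three matrices and \<open>l\<close> its length. The permutation \<open>\<sigma>\<close> uses the translates by \<open>l\<close>, \<open>\<tau>\<close>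
  those by \<open>2 l\<close>, so \<open>\<tau>\<close> separates \<open>A \<sigma> B\<close> from \<open>C\<close>. The permutation \<open>\<kappa>\<close> exchanges the translates by \<open>l\<close> with
  those by \<open>3 l\<close>; hence \<open>\<sigma>' = \<kappa> \<sigma> \<kappa>\<close> uses the translates by \<open>3 l\<close> and separates \<open>A\<close> from \<open>B \<tau> C\<close>. Finally \<open>\<kappa>\<close>
  commutes with \<open>A\<close>, \<open>B\<close>, \<open>C\<close>, which live in \<open>(s, t]\<close>, and with \<open>\<tau>\<close>, which has disjoint support, so the copies of \<open>\<kappa>\<close>
  in \<open>A \<sigma>' B \<tau> C\<close> travel to the two ends.\<close>

lemma coset_star_assoc:
  fixes A B C :: "'a::comm_ring_1 zmat"
  assumes I: "\<alpha> \<in> Ivals" "\<beta> \<in> Ivals" "\<gamma> \<in> Ivals" "\<delta> \<in> Ivals"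
    and GL: "A \<in> GL" "B \<in> GL" "C \<in> GL"
  shows "coset_star \<alpha> \<gamma> \<delta> (coset_star \<alpha> \<beta> \<gamma> (dcoset \<alpha> \<beta> A) (dcoset \<beta> \<gamma> B)) (dcoset \<gamma> \<delta> C) =
    coset_star \<alpha> \<beta> \<delta> (dcoset \<alpha> \<beta> A) (coset_star \<beta> \<gamma> \<delta> (dcoset \<beta> \<gamma> B) (dcoset \<gamma> \<delta> C))"
proof -
  note fin = finitary_GL[OF GL(1)] finitary_GL[OF GL(2)] finitary_GL[OF GL(3)]
  have "eventually (\<lambda>n.
      (- n \<le> fst \<alpha> \<and> fst \<alpha> \<le> n \<and> supported (- n) n A) \<and>
      (- n \<le> snd \<alpha> \<and> snd \<alpha> \<le> n \<and> supported (- n) n B) \<and>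
      (- n \<le> fst \<beta> \<and> fst \<beta> \<le> n \<and> supported (- n) n C) \<and>
      (- n \<le> snd \<beta> \<and> snd \<beta> \<le> n \<and> supported (- n) n C) \<and>
      (- n \<le> fst \<gamma> \<and> fst \<gamma> \<le> n \<and> supported (- n) n C) \<and>
      (- n \<le> snd \<gamma> \<and> snd \<gamma> \<le> n \<and> supported (- n) n C) \<and>
      (- n \<le> fst \<delta> \<and> fst \<delta> \<le> n \<and> supported (- n) n C) \<and>
      (- n \<le> snd \<delta> \<and> snd \<delta> \<le> n \<and> supported (- n) n C)) at_top"
    using fin by (intro eventually_conj eventually_square)
  from eventually_happens[OF this] obtain s t where sup: "supported s t A" "supported s t B" "supported s t C"
    and b: "s \<le> fst \<alpha>" "snd \<alpha> \<le> t" "s \<le> fst \<beta>" "snd \<beta> \<le> t" "s \<le> fst \<gamma>" "snd \<gamma> \<le> t"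
      "s \<le> fst \<delta>" "snd \<delta> \<le> t"
    by auto
  have le: "fst \<alpha> \<le> snd \<alpha>" "fst \<beta> \<le> snd \<beta>" "fst \<gamma> \<le> snd \<gamma>" "fst \<delta> \<le> snd \<delta>"
    using I by (auto simp: Ivals_def)
  define l where "l = t - s"
  have l: "0 \<le> l" "s = t - l" using b le by (auto simp: l_def)
  have st: "(s, t) \<in> Ivals" using l by (simp add: Ivals_def)
  define \<sigma> where "\<sigma> = swap_outer \<beta> (fst \<beta> - s) l (t - snd \<beta>) l"
  define \<tau> where "\<tau> = swap_outer \<gamma> (fst \<gamma> - s) (2 * l) (t - snd \<gamma>) (2 * l)"
  define \<kappa> where "\<kappa> = swap_outer (s, t) l (2 * l) l (2 * l)"
  define \<sigma>' where "\<sigma>' = \<kappa> \<circ> \<sigma> \<circ> \<kappa>"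
  have sep_\<sigma>: "separates \<beta> s t s t \<sigma>"
    unfolding separates_def \<sigma>_def using b le l(1)
    by (intro conjI block_perm_swap_outer I) (auto simp: swap_outer_def l_def)
  have sep_\<tau>: "separates \<gamma> (s - l) (t + l) s t \<tau>"
    unfolding separates_def \<tau>_def using b le l(1)
    by (intro conjI block_perm_swap_outer I) (auto simp: swap_outer_def l_def)
  have b\<kappa>: "block_perm (s, t) \<kappa>"
    unfolding \<kappa>_def using l by (intro block_perm_swap_outer st) auto
  have bp: "block_perm \<beta> \<sigma>" "block_perm \<gamma> \<tau>" "block_perm \<beta> \<kappa>"
    using sep_\<sigma> sep_\<tau> block_perm_mono[OF b\<kappa> I(2)] b by (auto simp: separates_def)
  have \<sigma>_fix: "\<sigma> x = x" if "\<not> (s - l < x \<and> x \<le> t + l)" for x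
    using that b le l by (auto simp: \<sigma>_def swap_outer_def)
  have \<tau>_fix: "\<tau> x = x" if "\<not> (s - 2 * l < x \<and> x \<le> s - l \<or> s < x \<and> x \<le> t \<or> t + l < x \<and> x \<le> t + 2 * l)" for x
    using that b le l by (auto simp: \<tau>_def swap_outer_def)
  have \<kappa>_fix: "\<kappa> x = x" if "s - 2 * l < x \<and> x \<le> s - l \<or> s < x \<and> x \<le> t \<or> t + l < x \<and> x \<le> t + 2 * l" for x
    using that l by (auto simp: \<kappa>_def swap_outer_def)
  have \<kappa>_out: "\<not> (s - l < \<kappa> x \<and> \<kappa> x \<le> t + l)"
    if x: "s - 2 * l < x" "x \<le> t + 2 * l" "\<not> (s < x \<and> x \<le> t)" for x
  proof -
    consider "s - 2 * l < x" "x \<le> s - l" | "s - l < x" "x \<le> s"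
      | "t < x" "x \<le> t + l" | "t + l < x" "x \<le> t + 2 * l"
      using x by linarith
    then show ?thesis
    proof cases
      case 2
      then have "\<kappa> x = x - 2 * l" by (simp add: \<kappa>_def swap_outer_def)
      then show ?thesis using 2 by linarith
    next
      case 3
      then have "\<kappa> x = x + 2 * l" using l(1) st by (simp add: \<kappa>_def swap_outer_def Ivals_def)
      then show ?thesis using 3 by linarith
    qed (use \<kappa>_fix[of x] l in auto)
  qed
  have sep_\<sigma>': "separates \<beta> s t (s - 2 * l) (t + 2 * l) \<sigma>'"
    unfolding separates_def
  proof (intro conjI allI impI)
    show "block_perm \<beta> \<sigma>'" using bp by (simp add: \<sigma>'_def)
    fix x assume x: "s - 2 * l < x \<and> x \<le> t + 2 * l \<and> \<not> (fst \<beta> < x \<and> x \<le> snd \<beta>)"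
    have "\<not> (s < \<sigma> (\<kappa> x) \<and> \<sigma> (\<kappa> x) \<le> t)"
    proof (cases "s < x \<and> x \<le> t")
      case True
      then show ?thesis using sep_\<sigma> x \<kappa>_fix[of x] by (auto simp: separates_def)
    next
      case False
      then show ?thesis using \<sigma>_fix[of "\<kappa> x"] \<kappa>_out[of x] x l(1) by auto
    qed
    then show "\<not> (s < \<sigma>' x \<and> \<sigma>' x \<le> t)"
      using block_permD(2,3)[OF b\<kappa>, of "\<sigma> (\<kappa> x)"] by (auto simp: \<sigma>'_def)
  qed
  have gl: "perm_mat \<sigma> \<in> (GL :: 'a zmat set)" "perm_mat \<sigma>' \<in> (GL :: 'a zmat set)"
    "perm_mat \<tau> \<in> (GL :: 'a zmat set)" "perm_mat \<kappa> \<in> (GL :: 'a zmat set)"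
    using bp sep_\<sigma>' perm_mat_GL unfolding separates_def by blast+
  have comm: "\<kappa> \<circ> \<tau> = \<tau> \<circ> \<kappa>"
    using block_permD(1)[OF bp(2)] block_permD(1)[OF bp(3)] \<kappa>_fix \<tau>_fix
    by (intro disjoint_support_commute) (auto simp: bij_is_inj)
  have P\<sigma>': "perm_mat \<sigma>' = perm_mat \<kappa> \<odot> (perm_mat \<sigma> \<odot> (perm_mat \<kappa> :: 'a zmat))"
    using gl block_permD(1)[OF b\<kappa>] block_permD(1)[OF bp(1)]
    by (simp add: \<sigma>'_def perm_mat_comp bij_comp o_assoc)
  have P\<tau>: "perm_mat \<kappa> \<odot> perm_mat \<tau> = perm_mat \<tau> \<odot> (perm_mat \<kappa> :: 'a zmat)"
    using block_permD(1)[OF b\<kappa>] block_permD(1)[OF bp(2)] by (simp add: perm_mat_comp comm)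
  have sU: "supported (s - l) (t + l) (A \<odot> perm_mat \<sigma> \<odot> B)"
    using l(1) b le
    by (intro supported_zmult supported_mono[OF sup(1)] supported_mono[OF sup(2)] supported_perm_mat[OF bp(1)])
      (auto intro: \<sigma>_fix)
  have sV: "supported (s - 2 * l) (t + 2 * l) (B \<odot> perm_mat \<tau> \<odot> C)"
    using l(1) b le
    by (intro supported_zmult supported_mono[OF sup(2)] supported_mono[OF sup(3)] supported_perm_mat[OF bp(2)])
      (auto intro!: \<tau>_fix)
  have 1: "coset_star \<alpha> \<beta> \<gamma> (dcoset \<alpha> \<beta> A) (dcoset \<beta> \<gamma> B) = dcoset \<alpha> \<gamma> (A \<odot> perm_mat \<sigma> \<odot> B)"
    using GL I b sup sep_\<sigma> by (intro coset_star_separated separatedI) auto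
  have 2: "coset_star \<alpha> \<gamma> \<delta> (dcoset \<alpha> \<gamma> (A \<odot> perm_mat \<sigma> \<odot> B)) (dcoset \<gamma> \<delta> C)
      = dcoset \<alpha> \<delta> (A \<odot> perm_mat \<sigma> \<odot> B \<odot> perm_mat \<tau> \<odot> C)"
    using GL gl I b sup sep_\<tau> sU l(1)
    by (intro coset_star_separated separatedI[of _ _ "s - l" "t + l" _ s t]) auto
  have 3: "coset_star \<beta> \<gamma> \<delta> (dcoset \<beta> \<gamma> B) (dcoset \<gamma> \<delta> C) = dcoset \<beta> \<delta> (B \<odot> perm_mat \<tau> \<odot> C)"
    using GL I b sup separates_mono[OF sep_\<tau>, of s t s t] l(1)
    by (intro coset_star_separated separatedI[of _ _ s t _ s t]) auto
  have 4: "coset_star \<alpha> \<beta> \<delta> (dcoset \<alpha> \<beta> A) (dcoset \<beta> \<delta> (B \<odot> perm_mat \<tau> \<odot> C))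
      = dcoset \<alpha> \<delta> (A \<odot> perm_mat \<sigma>' \<odot> (B \<odot> perm_mat \<tau> \<odot> C))"
    using GL gl I b sup sep_\<sigma>' sV l(1)
    by (intro coset_star_separated separatedI[of _ _ s t _ "s - 2 * l" "t + 2 * l"]) auto
  have comA: "perm_mat \<kappa> \<odot> A = A \<odot> perm_mat \<kappa>" and comB: "perm_mat \<kappa> \<odot> B = B \<odot> perm_mat \<kappa>"
    and comC: "perm_mat \<kappa> \<odot> C = C \<odot> perm_mat \<kappa>"
    using perm_mat_commute[OF b\<kappa>] GL sup by blast+
  let ?K = "perm_mat \<kappa> :: 'a zmat"
  have "A \<odot> perm_mat \<sigma>' \<odot> (B \<odot> perm_mat \<tau> \<odot> C) = (A \<odot> ?K) \<odot> perm_mat \<sigma> \<odot> (?K \<odot> B) \<odot> perm_mat \<tau> \<odot> C"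
    using GL gl by (simp add: P\<sigma>' GL_assoc)
  also have "\<dots> = ?K \<odot> A \<odot> perm_mat \<sigma> \<odot> B \<odot> (?K \<odot> perm_mat \<tau>) \<odot> C"
    using GL gl unfolding comA[symmetric] comB by (simp add: GL_assoc)
  also have "\<dots> = ?K \<odot> A \<odot> perm_mat \<sigma> \<odot> B \<odot> perm_mat \<tau> \<odot> (?K \<odot> C)"
    using GL gl unfolding P\<tau> by (simp add: GL_assoc)
  also have "\<dots> = ?K \<odot> (A \<odot> perm_mat \<sigma> \<odot> B \<odot> perm_mat \<tau> \<odot> C) \<odot> ?K"
    using GL gl unfolding comC by (simp add: GL_assoc)
  finally have eq: "A \<odot> perm_mat \<sigma>' \<odot> (B \<odot> perm_mat \<tau> \<odot> C) = \<dots>" .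
  have K: "?K \<in> Q \<alpha>" "?K \<in> Q \<delta>"
    using I b by (auto intro!: perm_mat_Q block_perm_mono[OF b\<kappa>])
  have "dcoset \<alpha> \<delta> (A \<odot> perm_mat \<sigma>' \<odot> (B \<odot> perm_mat \<tau> \<odot> C)) = dcoset \<alpha> \<delta> (A \<odot> perm_mat \<sigma> \<odot> B \<odot> perm_mat \<tau> \<odot> C)"
    unfolding eq using GL gl K I by (simp add: dcoset_left dcoset_right)
  then show ?thesis by (simp add: 1 2 3 4)
qed

theorem theorem1p1:
  shows
    "(\<forall>\<alpha> \<in> Ivals. \<forall>\<beta> \<in> Ivals. \<forall>\<gamma> \<in> Ivals.
        \<forall>a \<in> dcosets \<alpha> \<beta>. \<forall>b \<in> dcosets \<beta> \<gamma>.
          (\<exists>!c :: 'a::comm_ring_1 zmat set. is_product \<alpha> \<beta> \<gamma> a b c)) \<and>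
     (\<forall>\<alpha> \<in> Ivals. \<forall>\<beta> \<in> Ivals. \<forall>\<gamma> \<in> Ivals. \<forall>\<delta> \<in> Ivals.
        \<forall>a \<in> dcosets \<alpha> \<beta>. \<forall>b \<in> dcosets \<beta> \<gamma>. \<forall>c \<in> dcosets \<gamma> \<delta>.
          coset_star \<alpha> \<gamma> \<delta> (coset_star \<alpha> \<beta> \<gamma> a b) c =
          coset_star \<alpha> \<beta> \<delta> a (coset_star \<beta> \<gamma> \<delta> b (c :: 'a zmat set)))"
proof (intro conjI ballI)
  fix \<alpha> \<beta> \<gamma> :: "int \<times> int" and a b :: "'a zmat set"
  assume "\<alpha> \<in> Ivals" "\<beta> \<in> Ivals" "\<gamma> \<in> Ivals" "a \<in> dcosets \<alpha> \<beta>" "b \<in> dcosets \<beta> \<gamma>"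
  then show "\<exists>!c. is_product \<alpha> \<beta> \<gamma> a b c" by (rule ex1_is_product)
next
  fix \<alpha> \<beta> \<gamma> \<delta> :: "int \<times> int" and a b c :: "'a zmat set"
  assume I: "\<alpha> \<in> Ivals" "\<beta> \<in> Ivals" "\<gamma> \<in> Ivals" "\<delta> \<in> Ivals"
    and "a \<in> dcosets \<alpha> \<beta>" "b \<in> dcosets \<beta> \<gamma>" "c \<in> dcosets \<gamma> \<delta>"
  then obtain A B C where "A \<in> GL" "B \<in> GL" "C \<in> GL"
    and "a = dcoset \<alpha> \<beta> A" "b = dcoset \<beta> \<gamma> B" "c = dcoset \<gamma> \<delta> C"
    by (auto elim!: dcosetsE)
  then show "coset_star \<alpha> \<gamma> \<delta> (coset_star \<alpha> \<beta> \<gamma> a b) c = coset_star \<alpha> \<beta> \<delta> a (coset_star \<beta> \<gamma> \<delta> b c)"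
    using coset_star_assoc[OF I] by simp
qed

end
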